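(* For $n\ge0$ let $c^n_{x,y}$ be the conductances of the set consisting of the bottom row $x_0,\dots,x_{2^n}$ of $V_n$ together with the top point $q_0$, and set $a_n=c^n_{q_0,x_0}=c^n_{q_0,x_{2^n}}$. Then $$c^n_{q_0,x_j}=2a_n\ \text{ for }0<j<2^n,\qquad a_n=\frac{7\cdot5^n}{3^n+6\cdot10^n}.$$ Moreover, let $u$ be the function of least energy with prescribed values $u(q_0)=a$ and $u(x_i)=t_i$, $0\le i\le2^{n+1}$, on the top point and on the bottom row $x_0,\dots,x_{2^{n+1}}$ of $V_{n+1}$. Then $b=u(\frac12(q_0+q_1))$ and $c=u(\frac12(q_0+q_2))$ are given by $$b=\frac{(3+2^{n+1}a_n)a+(2+2^{n+1}a_n)a_n\bigl(t_0+2\sum_{i=1}^{2^n-1}t_i+t_{2^n}\bigr)+a_n\bigl(t_{2^n}+2\sum_{i=2^n+1}^{2^{n+1}-1}t_i+t_{2^{n+1}}\bigr)}{(1+2^{n+1}a_n)(3+2^{n+1}a_n)},$$ $$c=\frac{(3+2^{n+1}a_n)a+a_n\bigl(t_0+2\sum_{i=1}^{2^n-1}t_i+t_{2^n}\bigr)+(2+2^{n+1}a_n)a_n\bigl(t_{2^n}+2\sum_{i=2^n+1}^{2^{n+1}-1}t_i+t_{2^{n+1}}\bigr)}{(1+2^{n+1}a_n)(3+2^{n+1}a_n)}.$$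
   Context: Let $q_0,q_1,q_2$ be the vertices of an equilateral triangle in the plane, $F_i(x)=\frac12(x+q_i)$, and let $SG$ (the Sierpinski gasket) be the unique nonempty compact set with $SG=\bigcup_{i}F_i(SG)$. For a word $w$ of length $m$ let $F_w=F_{w_1}\circ\cdots\circ F_{w_m}$. Put $V_0=\{q_0,q_1,q_2\}$, $V_m=\bigcup_iF_iV_{m-1}$; $x\sim_m y$ means $x\ne y$ and $x,y\in F_wV_0$ for some word $w$ of length $m$. The bottom row of $V_n$ consists of the points $x_i=q_1+\frac{i}{2^n}(q_2-q_1)$, $0\le i\le2^n$. The energy of a continuous $u:SG\to\mathbb{R}$ is $\mathcal{E}(u)=\lim_{m\to\infty}\left(\frac53\right)^m\sum_{\{x,y\}:x\sim_m y}(u(x)-u(y))^2$ (a nondecreasing limit), and $\operatorname{dom}\mathcal{E}$ is the set of continuous $u$ with $\mathcal{E}(u)<\infty$. For a nonempty set $A\subset V_n$ and values prescribed on $A$, there is a unique $u\in\operatorname{dom}\mathcal{E}$ of least energy with these values on $A$, and its energy has the form $\mathcal{E}(u)=\sum_{\{x,y\}\subset A}c_{x,y}(u(x)-u(y))^2$; the (uniquely determined, symmetric) coefficients $c_{x,y}$, $x\neq y$, are the conductances of $A$. *)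

theory Defs
  imports "HOL-Analysis.Analysis"
begin

text \<open>Only the values of \<open>q\<close> at 0, 1, 2 matter; these are the vertices of the triangle.\<close>

definition equilateral_triangle :: "(nat \<Rightarrow> real^2) \<Rightarrow> bool" where
  "equilateral_triangle q \<longleftrightarrow>
     q 0 \<noteq> q 1 \<and> dist (q 0) (q 1) = dist (q 1) (q 2) \<and> dist (q 1) (q 2) = dist (q 2) (q 0)"

definition sg_map :: "(nat \<Rightarrow> real^2) \<Rightarrow> nat \<Rightarrow> real^2 \<Rightarrow> real^2" where
  "sg_map q i x = (1/2) *\<^sub>R (x + q i)"

definition SG :: "(nat \<Rightarrow> real^2) \<Rightarrow> (real^2) set" where
  "SG q = (THE K. K \<noteq> {} \<and> compact K \<and> K = (\<Union>i<3. sg_map q i ` K))"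

definition word_map :: "(nat \<Rightarrow> real^2) \<Rightarrow> nat list \<Rightarrow> real^2 \<Rightarrow> real^2" where
  "word_map q w = foldr (\<lambda>i g. sg_map q i \<circ> g) w id"

definition adjacent :: "(nat \<Rightarrow> real^2) \<Rightarrow> nat \<Rightarrow> real^2 \<Rightarrow> real^2 \<Rightarrow> bool" where
  "adjacent q m x y \<longleftrightarrow>
     x \<noteq> y \<and> (\<exists>w. length w = m \<and> set w \<subseteq> {..<3} \<and>
       x \<in> word_map q w ` (q ` {..<3}) \<and> y \<in> word_map q w ` (q ` {..<3}))"

text \<open>Sums over unordered pairs are written as half the sum over ordered pairs.\<close>

definition graph_energy :: "(nat \<Rightarrow> real^2) \<Rightarrow> nat \<Rightarrow> (real^2 \<Rightarrow> real) \<Rightarrow> real" where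
  "graph_energy q m u =
     (5/3)^m * ((1/2) * (\<Sum>(x, y) \<in> {(x, y). adjacent q m x y}. (u x - u y)\<^sup>2))"

definition energy :: "(nat \<Rightarrow> real^2) \<Rightarrow> (real^2 \<Rightarrow> real) \<Rightarrow> ereal" where
  "energy q u = lim (\<lambda>m. ereal (graph_energy q m u))"

text \<open>A function on the gasket is represented by a function on the plane; its values
  outside the gasket are irrelevant.\<close>

definition dom_energy :: "(nat \<Rightarrow> real^2) \<Rightarrow> (real^2 \<Rightarrow> real) set" where
  "dom_energy q = {u. continuous_on (SG q) u \<and> energy q u < \<infinity>}"

text \<open>\<open>u\<close> has least energy among all functions taking the same values as \<open>u\<close> on \<open>A\<close>.\<close>

definition least_energy :: "(nat \<Rightarrow> real^2) \<Rightarrow> (real^2) set \<Rightarrow> (real^2 \<Rightarrow> real) \<Rightarrow> bool" where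
  "least_energy q A u \<longleftrightarrow>
     u \<in> dom_energy q \<and>
     (\<forall>v \<in> dom_energy q. (\<forall>x\<in>A. v x = u x) \<longrightarrow> energy q u \<le> energy q v)"

text \<open>The conductances are determined only for distinct points of \<open>A\<close>; they are set to 0 elsewhere
  to make the function unique.\<close>

definition conductance :: "(nat \<Rightarrow> real^2) \<Rightarrow> (real^2) set \<Rightarrow> real^2 \<Rightarrow> real^2 \<Rightarrow> real" where
  "conductance q A = (THE c.
     (\<forall>x y. c x y = c y x) \<and>
     (\<forall>x y. x \<notin> A \<or> y \<notin> A \<or> x = y \<longrightarrow> c x y = 0) \<and>
     (\<forall>u. least_energy q A u \<longrightarrow>
        energy q u = ereal ((1/2) * (\<Sum>x\<in>A. \<Sum>y\<in>A. c x y * (u x - u y)\<^sup>2))))"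

definition bottom_point :: "(nat \<Rightarrow> real^2) \<Rightarrow> nat \<Rightarrow> nat \<Rightarrow> real^2" where
  "bottom_point q n i = q 1 + (real i / 2^n) *\<^sub>R (q 2 - q 1)"

definition top_and_bottom :: "(nat \<Rightarrow> real^2) \<Rightarrow> nat \<Rightarrow> (real^2) set" where
  "top_and_bottom q n = insert (q 0) (bottom_point q n ` {..2^n})"

definition top_conductance :: "(nat \<Rightarrow> real^2) \<Rightarrow> nat \<Rightarrow> nat \<Rightarrow> real" where
  "top_conductance q n j = conductance q (top_and_bottom q n) (q 0) (bottom_point q n j)"

definition corner_conductance :: "(nat \<Rightarrow> real^2) \<Rightarrow> nat \<Rightarrow> real" where
  "corner_conductance q n = top_conductance q n 0"

end

(* The energy is self-similar: the graph energy of level m + 1 is 5/3 times the sum of the graph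
   energies of level m of the three restrictions. Hence the least energy with given values on the top
   point and the bottom row of level n + 1 is obtained from level n by minimising
     5/3 ((a - b)^2 + (b - c)^2 + (a - c)^2 + T_n(b, left half) + T_n(c, right half))
   over the values b, c at the midpoints below the top point, T_n being the least energy at level n.
   If T_n joins the top point to the bottom row with conductances alpha_n, 2 alpha_n, ..., 2 alpha_n,
   alpha_n, completing the square yields the formulas for b and c, the same shape for T_(n+1), and
   alpha_(n+1) = 5/3 alpha_n / (1 + 2^(n+1) alpha_n). The minimum is attained by gluing rescaled
   copies: a harmonic function on the top cell (a uniform limit of piecewise affine functions, as the
   harmonic extension rule contracts oscillations by 3/5) and minimisers of level n on the other two.
   The conductances are recovered from the energy form by polarisation. *)
theory Submission
  imports Defs
begin

section \<open>Barycentric coordinates and the geometry of the three contractions\<close>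

definition det2 :: "real^2 \<Rightarrow> real^2 \<Rightarrow> real" where
  "det2 x y = x $ 1 * y $ 2 - x $ 2 * y $ 1"

text \<open>Lagrange's identity in the plane, which reduces the non-degeneracy of the triangle to
  inner products of its sides.\<close>

lemma det2_square: "(det2 x y)\<^sup>2 = (x \<bullet> x) * (y \<bullet> y) - (x \<bullet> y)\<^sup>2"
  by (simp add: det2_def inner_vec_def UNIV_2 power2_eq_square algebra_simps)

lemma lessThan_3: "{..<3} = {0, 1, 2::nat}"
  by auto

lemma less_3_cases: "i < 3 \<Longrightarrow> i = 0 \<or> i = 1 \<or> i = (2::nat)"
  by auto

lemma all_less_3: "(\<forall>k<3. P k) \<longleftrightarrow> P 0 \<and> P 1 \<and> P (2::nat)"
  using less_3_cases by auto

locale gasket =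
  fixes q :: "nat \<Rightarrow> real^2"
  assumes equilateral: "equilateral_triangle q"
begin

abbreviation F :: "nat \<Rightarrow> real^2 \<Rightarrow> real^2" where
  "F \<equiv> sg_map q"

abbreviation area :: real where
  "area \<equiv> det2 (q 1 - q 0) (q 2 - q 0)"

text \<open>For the side vectors \<open>e\<close> and \<open>f\<close> from \<open>q 0\<close>,
  equal side lengths give \<open>e \<bullet> f = (e \<bullet> e) / 2\<close>, so the squared
  determinant is 3/4 of \<open>(e \<bullet> e)\<^sup>2\<close>.\<close>

lemma area_nonzero: "area \<noteq> 0"
proof -
  define e f where "e = q 1 - q 0" and "f = q 2 - q 0"
  have ne: "e \<noteq> 0"
    using equilateral by (auto simp: equilateral_triangle_def e_def)
  have "norm e = norm (f - e)" "norm (f - e) = norm f"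
    using equilateral
    by (auto simp: equilateral_triangle_def e_def f_def dist_norm norm_minus_commute)
  hence "e \<bullet> e = (f - e) \<bullet> (f - e)" "e \<bullet> e = f \<bullet> f"
    by (simp_all add: norm_eq)
  hence *: "f \<bullet> f = e \<bullet> e" "e \<bullet> f = (e \<bullet> e) / 2"
    by (simp_all add: inner_diff inner_commute)
  have "(det2 e f)\<^sup>2 = 3 / 4 * (e \<bullet> e)\<^sup>2"
    unfolding det2_square * by (simp add: power2_eq_square)
  moreover have "e \<bullet> e \<noteq> 0"
    using ne by simp
  ultimately show ?thesis
    by (auto simp: e_def f_def)
qed

text \<open>Barycentric coordinates with respect to the triangle.\<close>

definition lam :: "nat \<Rightarrow> real^2 \<Rightarrow> real" where
  "lam k x =
    (let l1 = det2 (x - q 0) (q 2 - q 0) / area; l2 = det2 (q 1 - q 0) (x - q 0) / area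
     in if k = 0 then 1 - l1 - l2 else if k = 1 then l1 else l2)"

lemma sum_lam: "lam 0 x + lam 1 x + lam 2 x = 1"
  by (simp add: lam_def Let_def)

lemma lam_decomposition: "x = lam 0 x *\<^sub>R q 0 + lam 1 x *\<^sub>R q 1 + lam 2 x *\<^sub>R q 2"
proof -
  \<comment> \<open>Cramer's rule with the denominator cleared, a polynomial identity in the
    coordinates.\<close>
  have 1: "area *\<^sub>R (x - q 0) =
      det2 (x - q 0) (q 2 - q 0) *\<^sub>R (q 1 - q 0) + det2 (q 1 - q 0) (x - q 0) *\<^sub>R (q 2 - q 0)"
    by (simp add: vec_eq_iff forall_2 det2_def algebra_simps)
  have "x - q 0 = (1 / area) *\<^sub>R (area *\<^sub>R (x - q 0))"
    using area_nonzero by simp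
  also have "\<dots> = lam 1 x *\<^sub>R (q 1 - q 0) + lam 2 x *\<^sub>R (q 2 - q 0)"
    unfolding 1 by (simp add: lam_def Let_def scaleR_add_right)
  finally have 2: "x - q 0 = lam 1 x *\<^sub>R (q 1 - q 0) + lam 2 x *\<^sub>R (q 2 - q 0)" .
  have 3: "lam 0 x = 1 - lam 1 x - lam 2 x"
    using sum_lam[of x] by linarith
  from 2 have "x = q 0 + (lam 1 x *\<^sub>R (q 1 - q 0) + lam 2 x *\<^sub>R (q 2 - q 0))"
    by (simp only: diff_eq_eq add.commute)
  thus ?thesis
    unfolding 3 by (simp add: algebra_simps)
qed

lemma lam_eqI:
  assumes "\<And>k. k < 3 \<Longrightarrow> lam k x = lam k y"
  shows "x = y"
proof -
  have e: "lam 0 x = lam 0 y" "lam 1 x = lam 1 y" "lam 2 x = lam 2 y"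
    using assms by auto
  show ?thesis
    using lam_decomposition[of x] unfolding e by (rule trans[OF _ lam_decomposition[symmetric]])
qed

lemma lam_vertex:
  assumes "i < 3" "k < 3"
  shows "lam k (q i) = (if k = i then 1 else 0)"
proof -
  have "det2 x x = 0" "det2 0 x = 0" "det2 x 0 = 0" for x
    by (simp_all add: det2_def)
  hence "i = 0 \<or> i = 1 \<or> i = 2 \<Longrightarrow> k = 0 \<or> k = 1 \<or> k = 2 \<Longrightarrow> ?thesis"
    using area_nonzero by (elim disjE) (simp_all add: lam_def Let_def)
  thus ?thesis
    using assms[THEN less_3_cases] by blast
qed

lemma lam_midpoint: "lam k ((1/2) *\<^sub>R (x + y)) = (lam k x + lam k y) / 2"
proof -
  have l: "det2 ((1/2) *\<^sub>R (x + y) - q 0) v = (det2 (x - q 0) v + det2 (y - q 0) v) / 2" for v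
    by (simp add: det2_def algebra_simps add_divide_distrib diff_divide_distrib)
  have r: "det2 v ((1/2) *\<^sub>R (x + y) - q 0) = (det2 v (x - q 0) + det2 v (y - q 0)) / 2" for v
    by (simp add: det2_def algebra_simps add_divide_distrib diff_divide_distrib)
  show ?thesis
    unfolding lam_def Let_def l r using area_nonzero by (auto simp: field_simps)
qed

lemma lam_F: "i < 3 \<Longrightarrow> k < 3 \<Longrightarrow> lam k (F i x) = (lam k x + (if k = i then 1 else 0)) / 2"
  by (simp add: sg_map_def lam_midpoint lam_vertex)

lemma continuous_on_lam: "continuous_on X (lam k)"
  using area_nonzero unfolding lam_def Let_def det2_def
  by (cases "k = 0"; cases "k = 1") (auto intro!: continuous_intros)

text \<open>The closed solid triangle, the starting set for the construction of the gasket.\<close>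

definition T :: "(real^2) set" where
  "T = {x. \<forall>k<3. 0 \<le> lam k x}"

lemma lam_le_1:
  assumes "x \<in> T" "k < 3"
  shows "lam k x \<le> 1"
  using assms sum_lam[of x] less_3_cases[OF assms(2)] by (auto simp: T_def all_less_3)

lemma compact_T: "compact T"
proof -
  have "T = (\<Inter>k\<in>{..<3}. {x. 0 \<le> lam k x})"
    by (auto simp: T_def)
  moreover have "closed {x. 0 \<le> lam k x}" for k
    using continuous_on_lam by (intro closed_Collect_le) auto
  ultimately have "closed T"
    by auto
  moreover have "bounded T"
  proof (rule boundedI)
    fix x assume x: "x \<in> T"
    have b: "\<bar>lam k x\<bar> \<le> 1" if "k < 3" for k
      using lam_le_1[OF x that] x that by (auto simp: T_def)
    have "norm x \<le> norm (lam 0 x *\<^sub>R q 0) + norm (lam 1 x *\<^sub>R q 1) + norm (lam 2 x *\<^sub>R q 2)"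
      by (subst lam_decomposition) (intro norm_triangle_le add_mono order_refl norm_triangle_ineq)
    also have "\<dots> \<le> norm (q 0) + norm (q 1) + norm (q 2)"
      using b by (intro add_mono) (auto intro: mult_left_le_one_le)
    finally show "norm x \<le> norm (q 0) + norm (q 1) + norm (q 2)" .
  qed
  ultimately show ?thesis
    by (simp add: compact_eq_bounded_closed)
qed

lemma vertex_in_T: "i < 3 \<Longrightarrow> q i \<in> T"
  by (simp add: T_def lam_vertex)

lemma F_in_T: "i < 3 \<Longrightarrow> x \<in> T \<Longrightarrow> F i x \<in> T"
  by (simp add: T_def lam_F)

lemma F_eq_iff [simp]: "F i x = F i y \<longleftrightarrow> x = y"
  by (simp add: sg_map_def)

lemma F_vertex_commute: "F i (q j) = F j (q i)"
  by (simp add: sg_map_def add.commute)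

lemma F_vertex_self [simp]: "F i (q i) = q i"
  by (simp add: sg_map_def scaleR_2[symmetric])

lemma continuous_on_F: "continuous_on X (F i)"
  unfolding sg_map_def by (intro continuous_intros)

lemma dist_F: "dist (F i x) (F i y) = dist x y / 2"
proof -
  have "F i x - F i y = (1/2) *\<^sub>R (x - y)"
    by (simp add: sg_map_def algebra_simps)
  thus ?thesis
    by (simp add: dist_norm)
qed

text \<open>Doubling coordinates in \<open>F i x = F j y\<close> gives
  \<open>lam j x = lam j y + 1\<close>, and coordinates on \<open>T\<close> lie between 0 and 1, so
  \<open>x\<close> is the vertex \<open>q j\<close>; symmetrically for \<open>y\<close>. Distinct
  cells therefore share at most one point, on which both the splitting of the energy and gluing
  rest.\<close>

lemma F_meet:
  assumes ij: "i < 3" "j < 3" "i \<noteq> j" and xy: "x \<in> T" "y \<in> T" "F i x = F j y"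
  shows "x = q j" "y = q i"
proof -
  have E: "lam k x + (if k = i then 1 else 0) = lam k y + (if k = j then 1 else 0)" if "k < 3" for k
    using lam_F[OF ij(1) that, of x] lam_F[OF ij(2) that, of y] xy(3) by simp
  have nn: "0 \<le> lam k x" "0 \<le> lam k y" "lam k x \<le> 1" "lam k y \<le> 1" if "k < 3" for k
    using xy that lam_le_1 by (auto simp: T_def)
  have xj: "lam j x = 1" and yi: "lam i y = 1"
    using E[of i] E[of j] nn[of i] nn[of j] ij by auto
  have "lam k x = lam k (q j) \<and> lam k y = lam k (q i)" if "k < 3" for k
    using E[of 0] E[of 1] E[of 2] nn[of 0] nn[of 1] nn[of 2] xj yi sum_lam[of x] sum_lam[of y]
      ij(3) less_3_cases[OF ij(1)] less_3_cases[OF ij(2)] less_3_cases[OF that]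
      lam_vertex[OF ij(1) that] lam_vertex[OF ij(2) that]
    by (elim disjE) simp_all
  thus "x = q j" "y = q i"
    by (auto intro: lam_eqI)
qed

section \<open>Construction and uniqueness of the attractor\<close>

fun prefractal :: "nat \<Rightarrow> (real^2) set" where
  "prefractal 0 = T"
| "prefractal (Suc m) = (\<Union>i<3. F i ` prefractal m)"

lemma compact_prefractal: "compact (prefractal m)"
  by (induction m) (auto intro!: compact_T compact_UN compact_continuous_image continuous_on_F)

lemma prefractal_Suc_subset: "prefractal (Suc m) \<subseteq> prefractal m"
proof (induction m)
  case 0
  show ?case
    by (auto intro: F_in_T)
next
  case (Suc m)
  thus ?case
    by (subst prefractal.simps(2), subst (2) prefractal.simps(2)) blast
qed

lemma prefractal_antimono: "m \<le> n \<Longrightarrow> prefractal n \<subseteq> prefractal m"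
  by (rule lift_Suc_antimono_le[of prefractal]) (rule prefractal_Suc_subset)

lemma vertex_in_prefractal: "i < 3 \<Longrightarrow> q i \<in> prefractal m"
proof (induction m)
  case 0
  thus ?case by (simp add: vertex_in_T)
next
  case (Suc m)
  hence "F i (q i) \<in> F i ` prefractal m"
    by blast
  with Suc.prems show ?case
    unfolding F_vertex_self by auto
qed

text \<open>An explicit model of the gasket; \<open>SG_eq_K\<close> identifies it with the definite
  description \<open>SG q\<close>.\<close>

definition K :: "(real^2) set" where
  "K = (\<Inter>m. prefractal m)"

lemma compact_K: "compact K"
  unfolding K_def using compact_prefractal by (intro compact_Inter) auto

lemma K_fix: "K = (\<Union>i<3. F i ` K)"
proof
  show "(\<Union>i<3. F i ` K) \<subseteq> K"
  proof
    fix x assume "x \<in> (\<Union>i<3. F i ` K)"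
    then obtain i y where "i < 3" "y \<in> K" "x = F i y"
      by auto
    hence "x \<in> prefractal (Suc m)" for m
      by (auto simp: K_def)
    thus "x \<in> K"
      using prefractal_Suc_subset unfolding K_def by blast
  qed
next
  show "K \<subseteq> (\<Union>i<3. F i ` K)"
  proof
    fix x assume x: "x \<in> K"
    \<comment> \<open>One cell must contain \<open>x\<close> at all levels: if cell \<open>i\<close>
      lost \<open>x\<close> at level \<open>M i\<close>, then by monotonicity no cell would contain
      \<open>x\<close> at the common later level \<open>M 0 + M 1 + M 2\<close>.\<close>
    have "\<exists>i<3. \<forall>m. x \<in> F i ` prefractal m"
    proof (rule ccontr)
      assume "\<not> ?thesis"
      hence "\<forall>i\<in>{..<3}. \<exists>m. x \<notin> F i ` prefractal m"
        by auto
      then obtain M where M: "\<And>i. i < 3 \<Longrightarrow> x \<notin> F i ` prefractal (M i)"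
        by (metis lessThan_iff)
      define m where "m = M 0 + M 1 + M 2"
      have "x \<in> prefractal (Suc m)"
        using x by (auto simp: K_def simp del: prefractal.simps)
      then obtain i where i: "i < 3" "x \<in> F i ` prefractal m"
        by auto
      have "M i \<le> m"
        using less_3_cases[OF i(1)] by (auto simp: m_def)
      hence "x \<in> F i ` prefractal (M i)"
        using i(2) prefractal_antimono by blast
      with M i show False
        by blast
    qed
    then obtain i where i: "i < 3" "\<And>m. x \<in> F i ` prefractal m"
      by blast
    obtain y where y: "x = F i y"
      using i(2)[of 0] by blast
    have "y \<in> prefractal m" for m
      using i(2)[of m] y by auto
    hence "y \<in> K"
      by (auto simp: K_def)
    thus "x \<in> (\<Union>i<3. F i ` K)"
      using i y by auto
  qed
qed

text \<open>The largest distance from a point of \<open>A\<close> to \<open>B\<close> is attained at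
  some \<open>F i y\<close>, and since \<open>F i\<close> halves distances it is at most half of
  itself. Used in both directions, this gives uniqueness of the attractor.\<close>

lemma attractor_subset:
  assumes A: "compact A" "A = (\<Union>i<3. F i ` A)"
    and B: "B \<noteq> {}" "compact B" "B = (\<Union>i<3. F i ` B)"
  shows "A \<subseteq> B"
proof (cases "A = {}")
  case False
  have "continuous_on A (\<lambda>x. infdist x B)"
    by (intro continuous_intros)
  then obtain x where x: "x \<in> A" "\<And>y. y \<in> A \<Longrightarrow> infdist y B \<le> infdist x B"
    using continuous_attains_sup[OF A(1) False] by blast
  obtain i y where y: "i < 3" "y \<in> A" "x = F i y"
    using x(1) A(2) by blast
  obtain z where z: "z \<in> B" "infdist y B = dist y z"
    using infdist_attains_inf[OF compact_imp_closed[OF B(2)] B(1)] by blast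
  have "F i z \<in> B"
    using z(1) y(1) B(3) by blast
  hence "infdist x B \<le> dist (F i y) (F i z)"
    unfolding y(3) by (rule infdist_le)
  also have "\<dots> = infdist y B / 2"
    by (simp add: dist_F z)
  also have "\<dots> \<le> infdist x B / 2"
    using x(2)[OF y(2)] by simp
  finally have s: "infdist x B \<le> 0"
    by simp
  show ?thesis
  proof
    fix v assume "v \<in> A"
    hence "infdist v B = 0"
      using x(2)[of v] s infdist_nonneg[of v B] by linarith
    thus "v \<in> B"
      using in_closed_iff_infdist_zero[OF compact_imp_closed[OF B(2)] B(1)] by simp
  qed
qed simp

lemma vertex_in_K: "i < 3 \<Longrightarrow> q i \<in> K"
  using vertex_in_prefractal by (auto simp: K_def)

lemma K_nonempty: "K \<noteq> {}"
  using vertex_in_K[of 0] by auto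

lemma SG_eq_K: "SG q = K"
  unfolding SG_def
proof (rule the_equality)
  show "K \<noteq> {} \<and> compact K \<and> K = (\<Union>i<3. F i ` K)"
    by (intro conjI K_nonempty compact_K K_fix)
next
  fix A assume A: "A \<noteq> {} \<and> compact A \<and> A = (\<Union>i<3. F i ` A)"
  note A' = conjunct1[OF A] conjunct1[OF conjunct2[OF A]] conjunct2[OF conjunct2[OF A]]
  show "A = K"
  proof (rule subset_antisym)
    show "A \<subseteq> K"
      by (rule attractor_subset[OF A'(2,3) K_nonempty compact_K K_fix])
    show "K \<subseteq> A"
      by (rule attractor_subset[OF compact_K K_fix A'])
  qed
qed

lemma K_subset_T: "K \<subseteq> T"
proof
  fix x assume "x \<in> K"
  hence "x \<in> prefractal 0"
    unfolding K_def by blast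
  thus "x \<in> T" by simp
qed

lemma F_in_K: "i < 3 \<Longrightarrow> x \<in> K \<Longrightarrow> F i x \<in> K"
  using K_fix by blast

lemma K_cases:
  assumes "x \<in> K"
  obtains i y where "i < 3" "y \<in> K" "x = F i y"
  using assms K_fix by blast

section \<open>Approximating graphs, self-similarity and monotonicity of the graph energies\<close>

lemma word_map_Nil [simp]: "word_map q [] x = x"
  by (simp add: word_map_def)

lemma word_map_Cons [simp]: "word_map q (i # w) x = F i (word_map q w x)"
  by (simp add: word_map_def)

lemma inj_on_vertex: "inj_on q {..<3}"
proof (rule inj_onI)
  fix i j assume ij: "i \<in> {..<3}" "j \<in> {..<3}" "q i = q j"
  have "lam i (q i) = 1"
    using ij lam_vertex[of i i] by simp
  with ij show "i = j"
    using lam_vertex[of j i] by (simp split: if_splits)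
qed

lemma adjacent_0: "adjacent q 0 x y \<longleftrightarrow> x \<noteq> y \<and> x \<in> q ` {..<3} \<and> y \<in> q ` {..<3}"
  by (auto simp: adjacent_def)

lemma adjacent_Suc:
  "adjacent q (Suc m) x y \<longleftrightarrow>
    (\<exists>i<3. \<exists>x' y'. adjacent q m x' y' \<and> x = F i x' \<and> y = F i y')" (is "?L \<longleftrightarrow> ?R")
proof
  assume ?L
  then obtain w a b where w: "length w = Suc m" "set w \<subseteq> {..<3}" "x \<noteq> y" "a < 3" "b < 3"
      "x = word_map q w (q a)" "y = word_map q w (q b)"
    by (auto simp: adjacent_def)
  obtain i w' where iw: "w = i # w'"
    using w(1) by (cases w) auto
  have "adjacent q m (word_map q w' (q a)) (word_map q w' (q b))"
    unfolding adjacent_def using w iw by (intro conjI exI[of _ w']) auto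
  thus ?R
    using w iw by auto
next
  assume ?R
  then obtain i x' y' w a b where w: "i < 3" "x = F i x'" "y = F i y'" "x' \<noteq> y'"
      "length w = m" "set w \<subseteq> {..<3}" "a < 3" "b < 3"
      "x' = word_map q w (q a)" "y' = word_map q w (q b)"
    by (auto simp: adjacent_def)
  thus ?L
    unfolding adjacent_def by (intro conjI exI[of _ "i # w"]) auto
qed

lemma adjacent_neq: "adjacent q m x y \<Longrightarrow> x \<noteq> y"
  by (simp add: adjacent_def)

lemma adjacent_in_K: "adjacent q m x y \<Longrightarrow> x \<in> K \<and> y \<in> K"
proof (induction m arbitrary: x y)
  case 0
  thus ?case using vertex_in_K by (auto simp: adjacent_0)
next
  case (Suc m)
  thus ?case using F_in_K by (auto simp: adjacent_Suc)
qed

definition edges :: "nat \<Rightarrow> ((real^2) \<times> (real^2)) set" where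
  "edges m = {(x, y). adjacent q m x y}"

lemma edges_0: "edges 0 = {(q 0, q 1), (q 1, q 0), (q 1, q 2), (q 2, q 1), (q 0, q 2), (q 2, q 0)}"
proof -
  have "q 0 \<noteq> q 1" "q 1 \<noteq> q 2" "q 0 \<noteq> q 2"
    using inj_on_vertex by (auto simp: inj_on_def lessThan_3)
  thus ?thesis
    by (auto simp: edges_def adjacent_0 lessThan_3)
qed

lemma edges_Suc: "edges (Suc m) = (\<Union>i<3. map_prod (F i) (F i) ` edges m)"
proof (intro set_eqI)
  fix p
  show "p \<in> edges (Suc m) \<longleftrightarrow> p \<in> (\<Union>i<3. map_prod (F i) (F i) ` edges m)"
    by (cases p) (force simp: edges_def adjacent_Suc)
qed

lemma finite_edges: "finite (edges m)"
  by (induction m) (auto simp: edges_0 edges_Suc)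

lemma edges_in_K: "(x, y) \<in> edges m \<Longrightarrow> x \<in> K \<and> y \<in> K \<and> x \<noteq> y"
  using adjacent_in_K adjacent_neq by (auto simp: edges_def)

text \<open>An edge has two distinct endpoints, but two cells share at most one point by
  \<open>F_meet\<close>. Hence no edge is counted twice when the energy is split over the
  cells.\<close>

lemma edges_disjoint:
  assumes "i < 3" "j < 3" "i \<noteq> j"
  shows "map_prod (F i) (F i) ` edges m \<inter> map_prod (F j) (F j) ` edges m = {}"
proof (rule ccontr)
  assume "\<not> ?thesis"
  then obtain x y x' y' where xy: "(x, y) \<in> edges m" "(x', y') \<in> edges m"
      "F i x = F j x'" "F i y = F j y'"
    by auto
  have "x = q j" "y = q j"
    using F_meet(1)[OF assms] edges_in_K[OF xy(1)] edges_in_K[OF xy(2)] xy(3,4) K_subset_T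
    by blast+
  thus False
    using edges_in_K[OF xy(1)] by simp
qed

lemma graph_energy_edges:
  "graph_energy q m u = (5/3)^m * ((1/2) * (\<Sum>(x, y) \<in> edges m. (u x - u y)\<^sup>2))"
  by (simp add: graph_energy_def edges_def)

lemma graph_energy_cong:
  assumes "\<And>x. x \<in> K \<Longrightarrow> u x = v x"
  shows "graph_energy q m u = graph_energy q m v"
proof -
  have "(\<Sum>(x, y) \<in> edges m. (u x - u y)\<^sup>2) = (\<Sum>(x, y) \<in> edges m. (v x - v y)\<^sup>2)"
    using edges_in_K assms by (intro sum.cong refl) auto
  thus ?thesis
    by (simp add: graph_energy_edges)
qed

definition E0 :: "(nat \<Rightarrow> real) \<Rightarrow> real" where
  "E0 v = (v 0 - v 1)\<^sup>2 + (v 1 - v 2)\<^sup>2 + (v 0 - v 2)\<^sup>2"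

lemma graph_energy_0: "graph_energy q 0 u = E0 (\<lambda>k. u (q k))"
proof -
  have "q 0 \<noteq> q 1" "q 1 \<noteq> q 2" "q 0 \<noteq> q 2"
    using inj_on_vertex by (auto simp: inj_on_def lessThan_3)
  thus ?thesis
    by (simp add: graph_energy_edges edges_0 E0_def power2_commute)
qed

lemma graph_energy_Suc: "graph_energy q (Suc m) u = 5/3 * (\<Sum>i<3. graph_energy q m (u \<circ> F i))"
proof -
  have "(\<Sum>(x, y) \<in> edges (Suc m). (u x - u y)\<^sup>2) =
      (\<Sum>i<3. \<Sum>(x, y) \<in> map_prod (F i) (F i) ` edges m. (u x - u y)\<^sup>2)"
    unfolding edges_Suc using finite_edges edges_disjoint
    by (intro sum.UNION_disjoint) auto
  also have "\<dots> = (\<Sum>i<3. \<Sum>(x, y) \<in> edges m. ((u \<circ> F i) x - (u \<circ> F i) y)\<^sup>2)"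
  proof (rule sum.cong[OF refl])
    fix i :: nat
    have "inj_on (map_prod (F i) (F i)) (edges m)"
      by (intro inj_onI) auto
    thus "(\<Sum>(x, y) \<in> map_prod (F i) (F i) ` edges m. (u x - u y)\<^sup>2) =
        (\<Sum>(x, y) \<in> edges m. ((u \<circ> F i) x - (u \<circ> F i) y)\<^sup>2)"
      by (subst sum.reindex) (auto intro: sum.cong)
  qed
  finally show ?thesis
    by (simp add: graph_energy_edges sum_distrib_left mult_ac)
qed

lemma sum_less_3: "(\<Sum>i<3. f i) = f 0 + f 1 + (f 2 :: real)" for f :: "nat \<Rightarrow> real"
  by (simp add: lessThan_3)

text \<open>The bracket on the right measures the deviation of the values at the midpoints from the
  harmonic ones.\<close>

lemma harmonic_step:
  fixes a b c x y z :: real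
  defines "X \<equiv> x - (2*a + 2*b + c) / 5" and "Y \<equiv> y - (2*a + b + 2*c) / 5"
    and "Z \<equiv> z - (a + 2*b + 2*c) / 5"
  shows "5/3 * (((a - x)\<^sup>2 + (x - y)\<^sup>2 + (a - y)\<^sup>2) + ((x - b)\<^sup>2 + (b - z)\<^sup>2 + (x - z)\<^sup>2)
      + ((y - z)\<^sup>2 + (z - c)\<^sup>2 + (y - c)\<^sup>2)) =
    (a - b)\<^sup>2 + (b - c)\<^sup>2 + (a - c)\<^sup>2 +
      5/3 * (2 * (X\<^sup>2 + Y\<^sup>2 + Z\<^sup>2) + (X - Y)\<^sup>2 + (Y - Z)\<^sup>2 + (X - Z)\<^sup>2)"
  unfolding X_def Y_def Z_def by (simp add: field_simps power2_eq_square)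

text \<open>At level 0 the excess in \<open>harmonic_step\<close> is a sum of squares;
  self-similarity carries the inequality to higher levels.\<close>

lemma graph_energy_Suc_mono: "graph_energy q m u \<le> graph_energy q (Suc m) u"
proof (induction m arbitrary: u)
  case 0
  \<comment> \<open>Each of the three midpoints lies in two cells; one name is fixed for each so
    that the terms match \<open>harmonic_step\<close>.\<close>
  have c: "F 1 (q 0) = F 0 (q 1)" "F 2 (q 0) = F 0 (q 2)" "F 2 (q 1) = F 1 (q 2)"
    by (rule F_vertex_commute)+
  have "graph_energy q (Suc 0) u = 5/3 * (
      ((u (q 0) - u (F 0 (q 1)))\<^sup>2 + (u (F 0 (q 1)) - u (F 0 (q 2)))\<^sup>2 + (u (q 0) - u (F 0 (q 2)))\<^sup>2) +
      ((u (F 0 (q 1)) - u (q 1))\<^sup>2 + (u (q 1) - u (F 1 (q 2)))\<^sup>2 + (u (F 0 (q 1)) - u (F 1 (q 2)))\<^sup>2) +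
      ((u (F 0 (q 2)) - u (F 1 (q 2)))\<^sup>2 + (u (F 1 (q 2)) - u (q 2))\<^sup>2 + (u (F 0 (q 2)) - u (q 2))\<^sup>2))"
    by (simp only: graph_energy_Suc graph_energy_0 sum_less_3 E0_def o_def c F_vertex_self)
  also have "graph_energy q 0 u \<le> \<dots>"
    unfolding harmonic_step by (simp add: graph_energy_0 E0_def)
  finally show ?case .
next
  case (Suc m)
  have "graph_energy q (Suc m) u = 5/3 * (\<Sum>i<3. graph_energy q m (u \<circ> F i))"
    by (rule graph_energy_Suc)
  also have "\<dots> \<le> 5/3 * (\<Sum>i<3. graph_energy q (Suc m) (u \<circ> F i))"
    by (intro mult_left_mono sum_mono Suc.IH) auto
  also have "\<dots> = graph_energy q (Suc (Suc m)) u"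
    by (rule graph_energy_Suc[symmetric])
  finally show ?case .
qed

text \<open>Monotonicity turns the limit into a supremum, so every graph energy is a lower bound for
  the energy.\<close>

lemma energy_eq_SUP: "energy q u = (SUP m. ereal (graph_energy q m u))"
  unfolding energy_def
  by (intro limI LIMSEQ_SUP) (auto intro!: incseq_SucI graph_energy_Suc_mono)

lemma graph_energy_le_energy: "ereal (graph_energy q m u) \<le> energy q u"
  unfolding energy_eq_SUP by (rule SUP_upper) simp

lemma energy_eqI:
  assumes "\<And>m. m \<ge> n \<Longrightarrow> graph_energy q m u = e"
  shows "energy q u = ereal e"
  unfolding energy_def using assms
  by (intro limI tendsto_eventually) (auto simp: eventually_sequentially)

section \<open>Gluing functions along the cells, and harmonic functions\<close>

definition unF :: "nat \<Rightarrow> real^2 \<Rightarrow> real^2" where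
  "unF i x = 2 *\<^sub>R x - q i"

lemma unF_F [simp]: "unF i (F i x) = x"
  by (simp add: unF_def sg_map_def)

text \<open>A junction point lies in two cells and \<open>LEAST\<close> picks one of them;
  \<open>glue_F\<close> shows that the choice does not matter when the pieces agree at the
  junctions.\<close>

definition glue :: "(nat \<Rightarrow> real^2 \<Rightarrow> real) \<Rightarrow> real^2 \<Rightarrow> real" where
  "glue f x = (let i = (LEAST i. i < 3 \<and> x \<in> F i ` K) in f i (unF i x))"

lemma glue_F:
  assumes compat: "\<And>i j. i < 3 \<Longrightarrow> j < 3 \<Longrightarrow> f i (q j) = f j (q i)"
    and "i < 3" "x \<in> K"
  shows "glue f (F i x) = f i x"
proof -
  define j where "j = (LEAST j. j < 3 \<and> F i x \<in> F j ` K)"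
  have "j < 3 \<and> F i x \<in> F j ` K"
    unfolding j_def by (rule LeastI[of _ i]) (use assms in auto)
  then obtain y where y: "j < 3" "y \<in> K" "F i x = F j y"
    by auto
  have "glue f (F i x) = f j (unF j (F i x))"
    by (simp only: glue_def Let_def j_def)
  hence g: "glue f (F i x) = f j y"
    unfolding y(3) by simp
  show ?thesis
  proof (cases "i = j")
    case True
    thus ?thesis using g y by simp
  next
    case False
    have "x = q j" "y = q i"
      using F_meet[OF assms(2) y(1) False _ _ y(3)] assms(3) y(2) K_subset_T by auto
    thus ?thesis
      using g compat assms(2) y(1) by simp
  qed
qed

text \<open>The pasting lemma for the three closed cells, with \<open>glue_F\<close> providing
  agreement on each of them.\<close>

lemma continuous_on_glue:
  assumes compat: "\<And>i j. i < 3 \<Longrightarrow> j < 3 \<Longrightarrow> f i (q j) = f j (q i)"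
    and cont: "\<And>i. i < 3 \<Longrightarrow> continuous_on K (f i)"
  shows "continuous_on K (glue f)"
proof -
  have "continuous_on (\<Union>i\<in>{..<3}. F i ` K) (glue f)"
  proof (rule continuous_on_closed_Union)
    fix i :: nat assume "i \<in> {..<3}"
    hence i: "i < 3" by simp
    show "closed (F i ` K)"
      by (intro compact_imp_closed compact_continuous_image compact_K continuous_on_F)
    have "continuous_on (F i ` K) (f i \<circ> unF i)"
    proof (rule continuous_on_compose)
      show "continuous_on (F i ` K) (unF i)"
        unfolding unF_def by (intro continuous_intros)
      have "unF i ` F i ` K = K"
        by (simp add: image_image)
      thus "continuous_on (unF i ` F i ` K) (f i)"
        using cont[OF i] by simp
    qed
    moreover have "(f i \<circ> unF i) x = glue f x" if "x \<in> F i ` K" for x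
      using that glue_F[of f i] compat i by auto
    ultimately show "continuous_on (F i ` K) (glue f)"
      by (metis (no_types, lifting) continuous_on_cong)
  qed auto
  thus ?thesis
    by (subst K_fix)
qed

text \<open>The harmonic extension rule: the midpoint of \<open>q i\<close> and \<open>q k\<close> gets the value
  \<open>(2 v i + 2 v k + v l) / 5\<close>, where \<open>l\<close> is the third vertex.\<close>

definition sub :: "nat \<Rightarrow> (nat \<Rightarrow> real) \<Rightarrow> nat \<Rightarrow> real" where
  "sub i v k = (if k = i then v i else (v 0 + v 1 + v 2 + v i + v k) / 5)"

lemma sub_commute: "sub i v j = sub j v i"
  by (simp add: sub_def)

lemma sub_self [simp]: "sub i v i = v i"
  by (simp add: sub_def)

text \<open>The case of equality in \<open>harmonic_step\<close>: the harmonic midpoint values make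
  all deviations vanish.\<close>

lemma E0_sub: "5/3 * (\<Sum>i<3. E0 (sub i v)) = E0 v"
  by (simp add: sum_less_3 E0_def sub_def field_simps power2_eq_square)

text \<open>On the gasket this applies the harmonic extension rule \<open>m\<close> times and then
  interpolates affinely on the cells of level \<open>m\<close>. The recursion peels off the
  outermost cell, matching \<open>graph_energy_Suc\<close>.\<close>

fun hseq :: "nat \<Rightarrow> (nat \<Rightarrow> real) \<Rightarrow> real^2 \<Rightarrow> real" where
  "hseq 0 v = (\<lambda>x. v 0 * lam 0 x + v 1 * lam 1 x + v 2 * lam 2 x)"
| "hseq (Suc m) v = glue (\<lambda>i. hseq m (sub i v))"

lemma hseq_vertex: "k < 3 \<Longrightarrow> hseq m v (q k) = v k"
proof (induction m arbitrary: v k)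
  case 0
  thus ?case
    using less_3_cases[OF 0] by (auto simp: lam_vertex)
next
  case (Suc m)
  have "glue (\<lambda>i. hseq m (sub i v)) (F k (q k)) = hseq m (sub k v) (q k)"
    by (rule glue_F) (auto simp: Suc vertex_in_K sub_commute)
  thus ?case
    by (simp add: Suc)
qed

lemma hseq_Suc_F:
  assumes "i < 3" "x \<in> K"
  shows "hseq (Suc m) v (F i x) = hseq m (sub i v) x"
proof -
  have "glue (\<lambda>i. hseq m (sub i v)) (F i x) = hseq m (sub i v) x"
    by (rule glue_F) (use assms in \<open>auto simp: hseq_vertex sub_commute\<close>)
  thus ?thesis by simp
qed

lemma continuous_on_hseq: "continuous_on K (hseq m v)"
proof (induction m arbitrary: v)
  case 0
  show ?case
    by (simp del: One_nat_def) (intro continuous_intros continuous_on_lam)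
next
  case (Suc m)
  show ?case
    unfolding hseq.simps
    by (intro continuous_on_glue Suc.IH) (auto simp: hseq_vertex sub_commute)
qed

text \<open>With \<open>k\<close> and \<open>l\<close> the vertices other than \<open>i\<close>, the
  differences of the new values are, up to sign, \<open>(2 * (v i - v k) + (v i - v l)) / 5\<close>,
  its mirror image, and \<open>(v k - v l) / 5\<close>. The first two give the factor 3/5.\<close>

lemma osc_sub:
  assumes osc: "\<And>i j. i < 3 \<Longrightarrow> j < 3 \<Longrightarrow> \<bar>v i - v j\<bar> \<le> r" and "i < 3" "j < 3" "k < 3"
  shows "\<bar>sub i v j - sub i v k\<bar> \<le> 3/5 * r"
proof -
  have "v 0 - v 1 \<le> r" "v 1 - v 0 \<le> r" "v 0 - v 2 \<le> r" "v 2 - v 0 \<le> r"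
      "v 1 - v 2 \<le> r" "v 2 - v 1 \<le> r"
    using osc[of 0 1] osc[of 0 2] osc[of 1 2] by (simp_all add: abs_le_iff)
  hence "sub i v j - sub i v k \<le> 3/5 * r" if "i = 0 \<or> i = 1 \<or> i = 2" "j = 0 \<or> j = 1 \<or> j = 2"
    "k = 0 \<or> k = 1 \<or> k = 2" for i j k :: nat
    using that by (elim disjE; simp add: sub_def field_simps; linarith?)
  hence "sub i v j - sub i v k \<le> 3/5 * r" "sub i v k - sub i v j \<le> 3/5 * r"
    using assms(2-4)[THEN less_3_cases] by blast+
  thus ?thesis
    by linarith
qed

text \<open>On the triangle the affine interpolation is a convex combination of the vertex
  values.\<close>

lemma hseq_0_bound:
  assumes osc: "\<And>i j. i < 3 \<Longrightarrow> j < 3 \<Longrightarrow> \<bar>v i - v j\<bar> \<le> r" and "i < 3" "x \<in> T"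
  shows "\<bar>hseq 0 v x - v i\<bar> \<le> r"
proof -
  have l: "0 \<le> lam k x" if "k < 3" for k
    using assms(3) that by (auto simp: T_def)
  have "hseq 0 v x - v i = hseq 0 v x - v i * (lam 0 x + lam 1 x + lam 2 x)"
    by (simp only: sum_lam mult_1_right)
  also have "\<dots> = lam 0 x * (v 0 - v i) + lam 1 x * (v 1 - v i) + lam 2 x * (v 2 - v i)"
    by (simp add: algebra_simps)
  also have "\<bar>\<dots>\<bar> \<le> \<bar>lam 0 x * (v 0 - v i)\<bar> + \<bar>lam 1 x * (v 1 - v i)\<bar> + \<bar>lam 2 x * (v 2 - v i)\<bar>"
    by linarith
  also have "\<dots> \<le> lam 0 x * r + lam 1 x * r + lam 2 x * r"
    unfolding abs_mult using l osc assms(2)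
    by (intro add_mono mult_mono) auto
  also have "\<dots> = (lam 0 x + lam 1 x + lam 2 x) * r"
    by (simp only: distrib_right)
  finally show ?thesis
    by (simp only: sum_lam mult_1_left)
qed

lemma hseq_step_bound:
  assumes "\<And>i j. i < 3 \<Longrightarrow> j < 3 \<Longrightarrow> \<bar>v i - v j\<bar> \<le> r" and "x \<in> K"
  shows "\<bar>hseq (Suc m) v x - hseq m v x\<bar> \<le> 2 * r * (3/5)^m"
  using assms
proof (induction m arbitrary: v r x)
  case 0
  obtain i y where y: "i < 3" "y \<in> K" "x = F i y"
    using K_cases[OF 0(2)] .
  \<comment> \<open>Both approximations are compared with their common value \<open>v i\<close> at
    the vertex \<open>q i\<close>; 3/5 r + r is at most 2 r.\<close>
  have "\<bar>hseq 0 (sub i v) y - sub i v i\<bar> \<le> 3/5 * r"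
    using osc_sub[of v r i] 0(1) y K_subset_T by (intro hseq_0_bound) auto
  moreover have "\<bar>hseq 0 v x - v i\<bar> \<le> r"
    using 0 y K_subset_T by (intro hseq_0_bound) auto
  moreover have "0 \<le> r"
    using 0(1)[of 0 0] by simp
  ultimately show ?case
    unfolding y(3) hseq_Suc_F[OF y(1,2)] sub_self by (simp del: hseq.simps; linarith)
next
  case (Suc m)
  obtain i y where y: "i < 3" "y \<in> K" "x = F i y"
    using K_cases[OF Suc.prems(2)] .
  have "\<bar>hseq (Suc m) (sub i v) y - hseq m (sub i v) y\<bar> \<le> 2 * (3/5 * r) * (3/5)^m"
    using osc_sub[of v r i] Suc.prems(1) y by (intro Suc.IH) auto
  thus ?case
    unfolding y(3) hseq_Suc_F[OF y(1,2)] by (simp del: hseq.simps add: mult_ac)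
qed

text \<open>The limit of \<open>hseq\<close>, written as a telescoping series so that the
  Weierstrass M-test yields uniform convergence.\<close>

definition harmonic :: "(nat \<Rightarrow> real) \<Rightarrow> real^2 \<Rightarrow> real" where
  "harmonic v x = hseq 0 v x + (\<Sum>m. hseq (Suc m) v x - hseq m v x)"

lemma uniform_limit_hseq: "uniform_limit K (\<lambda>m. hseq m v) (harmonic v) sequentially"
proof -
  define r where "r = \<bar>v 0 - v 1\<bar> + \<bar>v 0 - v 2\<bar> + \<bar>v 1 - v 2\<bar>"
  have r: "\<bar>v i - v j\<bar> \<le> r" if "i < 3" "j < 3" for i j
    using that[THEN less_3_cases] unfolding r_def by (elim disjE) simp_all
  have "uniform_limit K (\<lambda>n x. \<Sum>m<n. hseq (Suc m) v x - hseq m v x)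
      (\<lambda>x. \<Sum>m. hseq (Suc m) v x - hseq m v x) sequentially"
  proof (rule Weierstrass_m_test)
    show "norm (hseq (Suc m) v x - hseq m v x) \<le> 2 * r * (3/5)^m" if "x \<in> K" for m x
      using hseq_step_bound[of v r x m] r that by (simp del: hseq.simps)
    show "summable (\<lambda>m. 2 * r * (3/5)^m)"
      by (intro summable_mult summable_geometric) simp
  qed
  hence "uniform_limit K (\<lambda>n x. hseq 0 v x + (\<Sum>m<n. hseq (Suc m) v x - hseq m v x))
      (harmonic v) sequentially"
    unfolding harmonic_def[abs_def] by (intro uniform_limit_add uniform_limit_const)
  moreover have "hseq 0 v x + (\<Sum>m<n. hseq (Suc m) v x - hseq m v x) = hseq n v x" for n x
    using sum_lessThan_telescope[of "\<lambda>m. hseq m v x" n] by (simp del: hseq.simps)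
  ultimately show ?thesis
    by (simp only:)
qed

lemma continuous_on_harmonic: "continuous_on K (harmonic v)"
  by (rule uniform_limit_theorem[OF _ uniform_limit_hseq]) (auto intro!: always_eventually continuous_on_hseq)

lemma LIMSEQ_hseq: "x \<in> K \<Longrightarrow> (\<lambda>m. hseq m v x) \<longlonglongrightarrow> harmonic v x"
  by (rule tendsto_uniform_limitI[OF uniform_limit_hseq])

lemma harmonic_vertex:
  assumes "k < 3"
  shows "harmonic v (q k) = v k"
  using LIMSEQ_hseq[OF vertex_in_K[OF assms], of v] by (simp add: hseq_vertex assms LIMSEQ_const_iff)

lemma harmonic_F:
  assumes "i < 3" "x \<in> K"
  shows "harmonic v (F i x) = harmonic (sub i v) x"
proof -
  have "(\<lambda>m. hseq (Suc m) v (F i x)) \<longlonglongrightarrow> harmonic v (F i x)"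
    by (rule LIMSEQ_Suc[OF LIMSEQ_hseq[OF F_in_K[OF assms]]])
  hence "(\<lambda>m. hseq m (sub i v) x) \<longlonglongrightarrow> harmonic v (F i x)"
    by (simp only: hseq_Suc_F[OF assms])
  thus ?thesis
    using LIMSEQ_hseq[OF assms(2)] LIMSEQ_unique by blast
qed

text \<open>The restriction to cell \<open>i\<close> is again harmonic, with data
  \<open>sub i v\<close>, so \<open>E0_sub\<close> keeps the energy constant from level to
  level.\<close>

lemma graph_energy_harmonic: "graph_energy q m (harmonic v) = E0 v"
proof (induction m arbitrary: v)
  case 0
  show ?case
    unfolding graph_energy_0 E0_def by (simp add: harmonic_vertex)
next
  case (Suc m)
  have "graph_energy q m (harmonic v \<circ> F i) = E0 (sub i v)" if "i < 3" for i
    using graph_energy_cong[of "harmonic v \<circ> F i" "harmonic (sub i v)" m] that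
    by (simp add: harmonic_F Suc)
  hence "graph_energy q (Suc m) (harmonic v) = 5/3 * (\<Sum>i<3. E0 (sub i v))"
    unfolding graph_energy_Suc by (intro arg_cong[where f = "\<lambda>x. 5/3 * x"] sum.cong) auto
  thus ?case
    unfolding E0_sub .
qed

end

section \<open>Conductances, weights and the algebra of one minimisation step\<close>

text \<open>The solution of the recursion \<open>alpha_Suc\<close> with value 1 at
  \<open>n = 0\<close>. The recursion becomes affine for the reciprocal, which is why the closed
  form combines powers of 3/5 and of 2.\<close>

definition alpha :: "nat \<Rightarrow> real" where
  "alpha n = 7 * 5^n / (3^n + 6 * 10^n)"

lemma alpha_pos: "alpha n > 0"
  unfolding alpha_def by (intro divide_pos_pos add_pos_pos mult_pos_pos zero_less_power) simp_all

lemma alpha_Suc: "alpha (Suc n) = 5/3 * alpha n / (1 + 2 ^ Suc n * alpha n)"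
proof -
  define x y z :: real where "x = 3^n" and "y = 5^n" and "z = 2^n"
  have pos: "x > 0" "y > 0" "z > 0"
    by (simp_all add: x_def y_def z_def)
  have ten: "(10::real)^n = z * y"
    by (simp add: y_def z_def flip: power_mult_distrib)
  \<comment> \<open>\<open>A\<close> is the denominator of \<open>alpha n\<close> and
    \<open>3 * B\<close> that of \<open>alpha (Suc n)\<close>; the 20 is 6 + 14, the 14 coming from
    \<open>2 ^ Suc n * alpha n\<close>.\<close>
  define A B where "A = x + 6 * (z * y)" and "B = x + 20 * (z * y)"
  have p: "A > 0"
    using pos unfolding A_def by (intro add_pos_pos mult_pos_pos) auto
  have a: "alpha n = 7 * y / A" "alpha (Suc n) = 35 * y / (3 * B)"
    by (simp_all add: alpha_def ten A_def B_def algebra_simps flip: x_def y_def z_def)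
  have "1 + 2 ^ Suc n * alpha n = B / A"
    using p unfolding a by (simp add: field_simps A_def B_def flip: z_def)
  thus ?thesis
    using p by (simp add: a)
qed

text \<open>\<open>wt n\<close> gives the conductances to the top point up to the factor \<open>alpha n\<close>; \<open>wt_right n\<close> is
  its copy on the right half of the bottom row of level \<open>n + 1\<close>.\<close>

definition wt :: "nat \<Rightarrow> nat \<Rightarrow> real" where
  "wt n i = (if i = 0 \<or> i = 2^n then 1 else if i < 2^n then 2 else 0)"

definition wt_right :: "nat \<Rightarrow> nat \<Rightarrow> real" where
  "wt_right n i = (if 2^n \<le> i then wt n (i - 2^n) else 0)"

text \<open>At the middle index \<open>2^n\<close> the end weights of the two halves add up to 2,
  which preserves the pattern 1, 2, ..., 2, 1.\<close>

lemma wt_Suc: "wt (Suc n) i = wt n i + wt_right n i"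
  by (auto simp: wt_def wt_right_def)

lemma sum_right_half:
  fixes f :: "nat \<Rightarrow> real"
  shows "(\<Sum>i\<le>2^Suc n. if 2^n \<le> i then f i else 0) = (\<Sum>i\<le>2^n. f (2^n + i))"
proof -
  have "(\<Sum>i\<le>2^Suc n. if 2^n \<le> i then f i else 0) = (\<Sum>i\<in>{2^n..2^Suc n}. f i)"
    by (rule sum.mono_neutral_cong_right) auto
  also have "\<dots> = (\<Sum>i\<le>2^n. f (2^n + i))"
    by (rule sum.reindex_bij_witness[of _ "\<lambda>i. 2^n + i" "\<lambda>i. i - 2^n"]) auto
  finally show ?thesis .
qed

lemma sum_left_half:
  fixes f :: "nat \<Rightarrow> real"
  shows "(\<Sum>i\<le>2^Suc n. if i \<le> 2^n then f i else 0) = (\<Sum>i\<le>2^n. f i)"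
  by (rule sum.mono_neutral_cong_right) (auto intro: order_trans)

lemma sum_wt_left: "(\<Sum>i\<le>2^Suc n. wt n i * f i) = (\<Sum>i\<le>2^n. wt n i * f i)"
  by (rule sum.mono_neutral_right) (auto simp: wt_def intro: order_trans)

lemma sum_wt_right: "(\<Sum>i\<le>2^Suc n. wt_right n i * f i) = (\<Sum>i\<le>2^n. wt n i * f (2^n + i))"
  using sum_right_half[where f = "\<lambda>i. wt n (i - 2^n) * f i"]
  by (simp add: wt_right_def if_distrib[of "\<lambda>x. x * _"] cong: if_cong)

lemma total_wt: "(\<Sum>i\<le>2^n. wt n i) = 2^Suc n"
proof (induction n)
  case 0
  show ?case by (simp add: wt_def)
next
  case (Suc n)
  show ?case
    using sum_wt_left[of n "\<lambda>_. 1"] sum_wt_right[of n "\<lambda>_. 1"] Suc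
    by (simp add: wt_Suc sum.distrib)
qed

text \<open>The conductances within the bottom row; the last summand comes from eliminating the two
  midpoints below the top point.\<close>

fun bottom_cond :: "nat \<Rightarrow> nat \<Rightarrow> nat \<Rightarrow> real" where
  "bottom_cond 0 i j = 1"
| "bottom_cond (Suc n) i j = 5/3 * (
     (if i \<le> 2^n \<and> j \<le> 2^n then bottom_cond n i j else 0) +
     (if 2^n \<le> i \<and> 2^n \<le> j then bottom_cond n (i - 2^n) (j - 2^n) else 0) +
     (alpha n)\<^sup>2 / ((2 + 2^Suc n * alpha n)\<^sup>2 - 1) *
       ((2 + 2^Suc n * alpha n) * (wt n i * wt n j + wt_right n i * wt_right n j) +
        (wt n i * wt_right n j + wt_right n i * wt n j)))"

lemma bot_commute: "bottom_cond n i j = bottom_cond n j i"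
  by (induction n arbitrary: i j) (simp_all add: conj_commute mult.commute add.commute)

definition pair_form :: "nat \<Rightarrow> (nat \<Rightarrow> real) \<Rightarrow> real" where
  "pair_form n t = (\<Sum>i\<le>2^n. \<Sum>j\<le>2^n. bottom_cond n i j * (t i - t j)\<^sup>2)"

text \<open>The candidate for the least energy with value \<open>a\<close> at the top and
  \<open>t\<close> on the bottom row. \<open>pair_form\<close> runs over ordered pairs, hence the
  division by 2.\<close>

definition trace_form :: "nat \<Rightarrow> real \<Rightarrow> (nat \<Rightarrow> real) \<Rightarrow> real" where
  "trace_form n a t = alpha n * (\<Sum>i\<le>2^n. wt n i * (a - t i)\<^sup>2) + pair_form n t / 2"

lemma trace_form_cong:
  assumes "\<And>i. i \<le> 2^n \<Longrightarrow> t i = t' i"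
  shows "trace_form n a t = trace_form n a t'"
  using assms by (simp add: trace_form_def pair_form_def)

text \<open>Expanding the square reduces a product kernel to total masses and first and second
  moments. The new terms in \<open>bottom_cond (Suc n)\<close> are combinations of such
  kernels.\<close>

lemma sum_pair_products:
  fixes f g t :: "nat \<Rightarrow> real"
  shows "(\<Sum>i\<in>A. \<Sum>j\<in>A. f i * g j * (t i - t j)\<^sup>2) =
    sum g A * (\<Sum>i\<in>A. f i * (t i)\<^sup>2) + sum f A * (\<Sum>i\<in>A. g i * (t i)\<^sup>2)
      - 2 * (\<Sum>i\<in>A. f i * t i) * (\<Sum>i\<in>A. g i * t i)"
proof -
  have "(\<Sum>i\<in>A. \<Sum>j\<in>A. f i * g j * (t i - t j)\<^sup>2) =
    (\<Sum>i\<in>A. \<Sum>j\<in>A. (f i * (t i)\<^sup>2) * g j + f i * (g j * (t j)\<^sup>2) - 2 * ((f i * t i) * (g j * t j)))"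
    by (intro sum.cong refl) (simp add: power2_eq_square algebra_simps)
  also have "\<dots> = (\<Sum>i\<in>A. f i * (t i)\<^sup>2) * sum g A + sum f A * (\<Sum>i\<in>A. g i * (t i)\<^sup>2)
      - 2 * ((\<Sum>i\<in>A. f i * t i) * (\<Sum>i\<in>A. g i * t i))"
    by (simp only: sum.distrib sum_subtractf sum_product flip: sum_distrib_left)
  finally show ?thesis
    by (simp add: mult_ac)
qed

lemma sum_wt_square:
  "(\<Sum>i\<le>2^n. wt n i * (a - t i)\<^sup>2) =
    2^Suc n * a\<^sup>2 - 2 * a * (\<Sum>i\<le>2^n. wt n i * t i) + (\<Sum>i\<le>2^n. wt n i * (t i)\<^sup>2)"
proof -
  have "(\<Sum>i\<le>2^n. wt n i * (a - t i)\<^sup>2) =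
      (\<Sum>i\<le>2^n. a\<^sup>2 * wt n i - 2 * a * (wt n i * t i) + wt n i * (t i)\<^sup>2)"
    by (intro sum.cong refl) (simp add: power2_eq_square algebra_simps)
  thus ?thesis
    by (simp only: sum.distrib sum_subtractf total_wt flip: sum_distrib_left) (simp only: mult.commute)
qed

text \<open>\<open>L\<close>, \<open>R\<close> and \<open>P\<close>, \<open>P'\<close> are the
  weighted first and second moments of the two halves. The truncated terms of the recursion sum to
  the pair forms of the halves, the weight products to moments by
  \<open>sum_pair_products\<close>.\<close>

lemma pair_form_Suc:
  fixes n :: nat and t :: "nat \<Rightarrow> real"
  defines "W \<equiv> 2^Suc n" and "s \<equiv> 2 + 2^Suc n * alpha n"
    and "L \<equiv> \<Sum>i\<le>2^n. wt n i * t i" and "R \<equiv> \<Sum>i\<le>2^n. wt n i * t (2^n + i)"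
    and "P \<equiv> \<Sum>i\<le>2^n. wt n i * (t i)\<^sup>2" and "P' \<equiv> \<Sum>i\<le>2^n. wt n i * (t (2^n + i))\<^sup>2"
  shows "pair_form (Suc n) t = 5/3 * (pair_form n t + pair_form n (\<lambda>i. t (2^n + i)) +
    (alpha n)\<^sup>2 / (s\<^sup>2 - 1) *
      (s * ((2 * W * P - 2 * L\<^sup>2) + (2 * W * P' - 2 * R\<^sup>2)) + 2 * (W * P + W * P' - 2 * L * R)))"
proof -
  let ?A = "{..2^Suc n} :: nat set"
  let ?w = "wt n" and ?w' = "wt_right n"
  define d where "d i j = (t i - t j)\<^sup>2" for i j
  define k where "k = (alpha n)\<^sup>2 / (s\<^sup>2 - 1)"
  have sums: "sum ?w ?A = W" "sum ?w' ?A = W"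
    using sum_wt_left[of n "\<lambda>_. 1"] sum_wt_right[of n "\<lambda>_. 1"] total_wt[of n]
    by (simp_all add: W_def)
  have lin: "(\<Sum>i\<in>?A. ?w i * t i) = L" "(\<Sum>i\<in>?A. ?w' i * t i) = R"
    "(\<Sum>i\<in>?A. ?w i * (t i)\<^sup>2) = P" "(\<Sum>i\<in>?A. ?w' i * (t i)\<^sup>2) = P'"
    unfolding L_def R_def P_def P'_def by (rule sum_wt_left sum_wt_right)+
  have ll: "(\<Sum>i\<in>?A. \<Sum>j\<in>?A. ?w i * ?w j * d i j) = 2 * W * P - 2 * L\<^sup>2"
    and rr: "(\<Sum>i\<in>?A. \<Sum>j\<in>?A. ?w' i * ?w' j * d i j) = 2 * W * P' - 2 * R\<^sup>2"
    and lr: "(\<Sum>i\<in>?A. \<Sum>j\<in>?A. ?w i * ?w' j * d i j) = W * P + W * P' - 2 * L * R"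
    and rl: "(\<Sum>i\<in>?A. \<Sum>j\<in>?A. ?w' i * ?w j * d i j) = W * P + W * P' - 2 * L * R"
    unfolding d_def sum_pair_products sums lin by (simp_all add: power2_eq_square)
  have left: "(\<Sum>i\<in>?A. \<Sum>j\<in>?A. if i \<le> 2^n \<and> j \<le> 2^n then bottom_cond n i j * d i j else 0) = pair_form n t"
  proof -
    have "(\<Sum>j\<in>?A. if i \<le> 2^n \<and> j \<le> 2^n then bottom_cond n i j * d i j else 0) =
        (if i \<le> 2^n then (\<Sum>j\<le>2^n. bottom_cond n i j * d i j) else 0)" for i
      using sum_left_half[of n "\<lambda>j. bottom_cond n i j * d i j"] by simp
    thus ?thesis
      using sum_left_half[of n "\<lambda>i. \<Sum>j\<le>2^n. bottom_cond n i j * d i j"]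
      by (simp add: pair_form_def d_def)
  qed
  have right: "(\<Sum>i\<in>?A. \<Sum>j\<in>?A. if 2^n \<le> i \<and> 2^n \<le> j
      then bottom_cond n (i - 2^n) (j - 2^n) * d i j else 0) = pair_form n (\<lambda>i. t (2^n + i))"
  proof -
    have "(\<Sum>j\<in>?A. if 2^n \<le> i \<and> 2^n \<le> j then bottom_cond n (i - 2^n) (j - 2^n) * d i j else 0) =
        (if 2^n \<le> i then (\<Sum>j\<le>2^n. bottom_cond n (i - 2^n) j * d i (2^n + j)) else 0)" for i
      using sum_right_half[of n "\<lambda>j. bottom_cond n (i - 2^n) (j - 2^n) * d i j"] by simp
    thus ?thesis
      using sum_right_half[of n "\<lambda>i. \<Sum>j\<le>2^n. bottom_cond n (i - 2^n) j * d i (2^n + j)"]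
      by (simp add: pair_form_def d_def)
  qed
  have "pair_form (Suc n) t = (\<Sum>i\<in>?A. \<Sum>j\<in>?A.
      5/3 * ((if i \<le> 2^n \<and> j \<le> 2^n then bottom_cond n i j * d i j else 0) +
        (if 2^n \<le> i \<and> 2^n \<le> j then bottom_cond n (i - 2^n) (j - 2^n) * d i j else 0) +
        k * (s * (?w i * ?w j * d i j + ?w' i * ?w' j * d i j) +
          (?w i * ?w' j * d i j + ?w' i * ?w j * d i j))))"
    unfolding pair_form_def bottom_cond.simps d_def[symmetric] k_def s_def
    by (intro sum.cong refl) (simp add: algebra_simps)
  also have "\<dots> = 5/3 * (pair_form n t + pair_form n (\<lambda>i. t (2^n + i)) +
      k * (s * ((2 * W * P - 2 * L\<^sup>2) + (2 * W * P' - 2 * R\<^sup>2)) +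
        ((W * P + W * P' - 2 * L * R) + (W * P + W * P' - 2 * L * R))))"
    by (simp only: sum.distrib left right ll rr lr rl flip: sum_distrib_left)
  finally show ?thesis
    by (simp add: k_def)
qed

text \<open>Completing the square: \<open>p\<close> and \<open>r\<close> solve \<open>s p - r = a + \<alpha> L\<close> and \<open>s r - p = a + \<alpha> R\<close>.\<close>

lemma complete_square:
  fixes \<alpha> W a b c L R P P' :: real
  assumes "\<alpha> > 0" "W > 0"
  defines "s \<equiv> 2 + W * \<alpha>"
  defines "p \<equiv> (s * (a + \<alpha> * L) + (a + \<alpha> * R)) / (s\<^sup>2 - 1)"
    and "r \<equiv> ((a + \<alpha> * L) + s * (a + \<alpha> * R)) / (s\<^sup>2 - 1)"
  shows "(a - b)\<^sup>2 + (b - c)\<^sup>2 + (a - c)\<^sup>2 + \<alpha> * (W * b\<^sup>2 - 2 * b * L + P)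
      + \<alpha> * (W * c\<^sup>2 - 2 * c * R + P') =
    \<alpha> / (1 + W * \<alpha>) * (2 * W * a\<^sup>2 - 2 * a * (L + R) + (P + P')) +
      \<alpha>\<^sup>2 / (s\<^sup>2 - 1) * (s * ((2 * W * P - 2 * L\<^sup>2) + (2 * W * P' - 2 * R\<^sup>2))
        + 2 * (W * P + W * P' - 2 * L * R)) / 2 +
      (((b - p) - (c - r))\<^sup>2 + (1 + W * \<alpha>) * ((b - p)\<^sup>2 + (c - r)\<^sup>2))"
proof -
  \<comment> \<open>In \<open>b\<close> and \<open>c\<close> the form is \<open>s * b\<^sup>2 + s *
    c\<^sup>2 - 2 * b * c - 2 * b * X - 2 * c * Y\<close> plus a constant; \<open>D\<close> is the
    determinant of its matrix with rows (s, -1) and (-1, s).\<close>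
  define X Y D where "X = a + \<alpha> * L" and "Y = a + \<alpha> * R" and "D = s\<^sup>2 - 1"
  have wa: "W * \<alpha> > 0"
    using assms by simp
  have D: "D = (1 + W * \<alpha>) * (3 + W * \<alpha>)"
    by (simp add: D_def s_def power2_eq_square algebra_simps)
  have nz: "1 + W * \<alpha> \<noteq> 0" "D \<noteq> 0"
    unfolding D using wa by auto
  have pr: "D * p = s * X + Y" "D * r = X + s * Y"
    using nz(2) by (simp_all add: p_def r_def X_def Y_def flip: D_def)
  have "D * (s * p - r) = s * (D * p) - D * r" "D * (s * r - p) = s * (D * r) - D * p"
    by (simp_all add: algebra_simps)
  hence "D * (s * p - r) = D * X" "D * (s * r - p) = D * Y"
    unfolding pr by (simp_all add: D_def power2_eq_square algebra_simps)
  hence XY: "X = s * p - r" "Y = s * r - p"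
    using nz(2) by simp_all
  have quad: "D * (p * X + r * Y) = s * X\<^sup>2 + 2 * X * Y + s * Y\<^sup>2"
  proof -
    have "D * (p * X + r * Y) = (D * p) * X + (D * r) * Y"
      by (simp add: algebra_simps)
    thus ?thesis
      unfolding pr by (simp add: power2_eq_square algebra_simps)
  qed
  define J where "J = s * ((2 * W * P - 2 * L\<^sup>2) + (2 * W * P' - 2 * R\<^sup>2))
        + 2 * (W * P + W * P' - 2 * L * R)"
  define M where "M = 2 * W * a\<^sup>2 - 2 * a * (L + R) + (P + P')"
  \<comment> \<open>The left side is the value at the critical point. Multiplying by
    \<open>D\<close> removes the denominators: \<open>quad\<close> does so on the left, the
    factorisation of \<open>D\<close> on the right.\<close>
  have rest: "2 * a\<^sup>2 + \<alpha> * (P + P') - (p * X + r * Y) = \<alpha> / (1 + W * \<alpha>) * M + \<alpha>\<^sup>2 / D * J / 2"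
  proof -
    have e1: "D * (\<alpha> / (1 + W * \<alpha>) * M) = (3 + W * \<alpha>) * \<alpha> * M"
      unfolding D using nz(1) by simp
    have e2: "D * (\<alpha>\<^sup>2 / D * J / 2) = \<alpha>\<^sup>2 * J / 2"
      using nz(2) by simp
    have "D * (2 * a\<^sup>2 + \<alpha> * (P + P') - (p * X + r * Y)) =
        D * (2 * a\<^sup>2 + \<alpha> * (P + P')) - (s * X\<^sup>2 + 2 * X * Y + s * Y\<^sup>2)"
      by (simp only: right_diff_distrib quad)
    also have "\<dots> = (3 + W * \<alpha>) * \<alpha> * M + \<alpha>\<^sup>2 * J / 2"
      unfolding D X_def Y_def M_def J_def s_def
      by (simp add: power2_eq_square field_simps)
    also have "\<dots> = D * (\<alpha> / (1 + W * \<alpha>) * M + \<alpha>\<^sup>2 / D * J / 2)"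
      by (simp only: distrib_left e1 e2)
    finally show ?thesis
      using nz(2) by simp
  qed
  have "(a - b)\<^sup>2 + (b - c)\<^sup>2 + (a - c)\<^sup>2 + \<alpha> * (W * b\<^sup>2 - 2 * b * L + P)
      + \<alpha> * (W * c\<^sup>2 - 2 * c * R + P') =
      2 * a\<^sup>2 + \<alpha> * (P + P') + s * b\<^sup>2 + s * c\<^sup>2 - 2 * b * c - 2 * b * X - 2 * c * Y"
    unfolding s_def X_def Y_def by (simp add: power2_eq_square algebra_simps)
  \<comment> \<open>The equations \<open>XY\<close> make the terms linear in \<open>b - p\<close>
    and \<open>c - r\<close> cancel.\<close>
  also have "\<dots> = (2 * a\<^sup>2 + \<alpha> * (P + P') - (p * X + r * Y)) +
      (((b - p) - (c - r))\<^sup>2 + (s - 1) * ((b - p)\<^sup>2 + (c - r)\<^sup>2))"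
    unfolding XY by (simp add: power2_eq_square algebra_simps)
  finally show ?thesis
    unfolding rest M_def J_def D_def by (simp add: s_def)
qed

text \<open>The critical value \<open>p\<close> of \<open>complete_square\<close>, the optimal value
  at the midpoint of \<open>q 0\<close> and \<open>q 1\<close>; \<open>mid_right\<close> is the
  corresponding \<open>r\<close>.\<close>

definition mid_left :: "nat \<Rightarrow> real \<Rightarrow> (nat \<Rightarrow> real) \<Rightarrow> real" where
  "mid_left n a t = (let s = 2 + 2^Suc n * alpha n in
    (s * (a + alpha n * (\<Sum>i\<le>2^n. wt n i * t i)) + (a + alpha n * (\<Sum>i\<le>2^n. wt n i * t (2^n + i))))
      / (s\<^sup>2 - 1))"

definition mid_right :: "nat \<Rightarrow> real \<Rightarrow> (nat \<Rightarrow> real) \<Rightarrow> real" where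
  "mid_right n a t = (let s = 2 + 2^Suc n * alpha n in
    ((a + alpha n * (\<Sum>i\<le>2^n. wt n i * t i)) + s * (a + alpha n * (\<Sum>i\<le>2^n. wt n i * t (2^n + i))))
      / (s\<^sup>2 - 1))"

text \<open>An exact identity rather than an inequality: its remainder is positive definite in
  \<open>x\<close> and \<open>y\<close>, so it yields the minimum and the uniqueness of the
  minimising midpoint values together.\<close>

lemma trace_form_step:
  fixes n :: nat and a b c :: real and t :: "nat \<Rightarrow> real"
  defines "x \<equiv> b - mid_left n a t" and "y \<equiv> c - mid_right n a t"
  shows "5/3 * (((a - b)\<^sup>2 + (b - c)\<^sup>2 + (a - c)\<^sup>2) + trace_form n b t
      + trace_form n c (\<lambda>i. t (2^n + i))) =
    trace_form (Suc n) a t + 5/3 * ((x - y)\<^sup>2 + (1 + 2^Suc n * alpha n) * (x\<^sup>2 + y\<^sup>2))"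
proof -
  let ?s = "2 + 2^Suc n * alpha n"
  define L where "L = (\<Sum>i\<le>2^n. wt n i * t i)"
  define R where "R = (\<Sum>i\<le>2^n. wt n i * t (2^n + i))"
  define P where "P = (\<Sum>i\<le>2^n. wt n i * (t i)\<^sup>2)"
  define P' where "P' = (\<Sum>i\<le>2^n. wt n i * (t (2^n + i))\<^sup>2)"
  have sums: "(\<Sum>i\<le>2^Suc n. wt (Suc n) i * t i) = L + R"
      "(\<Sum>i\<le>2^Suc n. wt (Suc n) i * (t i)\<^sup>2) = P + P'"
    unfolding wt_Suc distrib_right sum.distrib L_def R_def P_def P'_def
      sum_wt_left sum_wt_right by (rule refl)+
  \<comment> \<open>Here \<open>u\<close> and \<open>v\<close> stand for the pair forms of the
    halves, which do not depend on \<open>b\<close> and \<open>c\<close> and are carried through the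
    minimisation.\<close>
  have lin: "5/3 * (l + u/2 + v/2) = (5/3 * m + 5/3 * (u + v + j) / 2) + 5/3 * d"
    if "l = m + j/2 + d" for l m j d u v :: real
    using that by simp
  have W: "(2::real)^Suc (Suc n) = 2 * 2^Suc n"
    by simp
  have main: "(a - b)\<^sup>2 + (b - c)\<^sup>2 + (a - c)\<^sup>2 + alpha n * (2^Suc n * b\<^sup>2 - 2 * b * L + P)
      + alpha n * (2^Suc n * c\<^sup>2 - 2 * c * R + P') =
    alpha n / (1 + 2^Suc n * alpha n) * (2 * 2^Suc n * a\<^sup>2 - 2 * a * (L + R) + (P + P')) +
      (alpha n)\<^sup>2 / (?s\<^sup>2 - 1) * (?s * ((2 * 2^Suc n * P - 2 * L\<^sup>2) + (2 * 2^Suc n * P' - 2 * R\<^sup>2))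
        + 2 * (2^Suc n * P + 2^Suc n * P' - 2 * L * R)) / 2 +
      ((x - y)\<^sup>2 + (1 + 2^Suc n * alpha n) * (x\<^sup>2 + y\<^sup>2))" (is "?lhs = ?m + ?j / 2 + ?d")
    unfolding x_def y_def mid_left_def mid_right_def Let_def
      L_def[symmetric] R_def[symmetric]
    by (rule complete_square) (simp_all add: alpha_pos)
  have lhs: "((a - b)\<^sup>2 + (b - c)\<^sup>2 + (a - c)\<^sup>2) + trace_form n b t + trace_form n c (\<lambda>i. t (2^n + i)) =
      ?lhs + pair_form n t / 2 + pair_form n (\<lambda>i. t (2^n + i)) / 2"
    unfolding trace_form_def sum_wt_square L_def[symmetric] R_def[symmetric] P_def[symmetric]
      P'_def[symmetric] by simp
  have tr: "trace_form (Suc n) a t = 5/3 * ?m + 5/3 * (pair_form n t + pair_form n (\<lambda>i. t (2^n + i)) + ?j) / 2"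
    unfolding trace_form_def sum_wt_square sums W alpha_Suc pair_form_Suc L_def[symmetric]
      R_def[symmetric] P_def[symmetric] P'_def[symmetric] by simp
  show ?thesis
    unfolding lhs tr by (rule lin) (rule main)
qed

section \<open>Least energy with prescribed values on the top point and the bottom row\<close>

context gasket
begin

lemma F_bottom_left: "F 1 (bottom_point q n i) = bottom_point q (Suc n) i"
  by (simp add: sg_map_def bottom_point_def algebra_simps flip: scaleR_2)

lemma F_bottom_right: "F 2 (bottom_point q n i) = bottom_point q (Suc n) (2^n + i)"
proof -
  have "real (2^n + i) / 2^Suc n = 1/2 + real i / 2^n / 2"
    by (simp add: field_simps)
  thus ?thesis
    by (simp add: sg_map_def bottom_point_def algebra_simps scaleR_half_double)
qed

lemma bottom_point_0 [simp]: "bottom_point q n 0 = q 1"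
  by (simp add: bottom_point_def)

lemma bottom_point_end [simp]: "bottom_point q n (2^n) = q 2"
  by (simp add: bottom_point_def)

lemma bottom_point_Suc_cases:
  assumes "i \<le> 2^Suc n"
  obtains "i \<le> 2^n" "bottom_point q (Suc n) i = F 1 (bottom_point q n i)"
  | k where "k \<le> 2^n" "i = 2^n + k" "bottom_point q (Suc n) i = F 2 (bottom_point q n k)"
proof (cases "i \<le> 2^n")
  case True
  thus ?thesis using that(1) F_bottom_left by simp
next
  case False
  thus ?thesis using that(2)[of "i - 2^n"] assms F_bottom_right[of n "i - 2^n"] by simp
qed

lemma bottom_point_in_K: "i \<le> 2^n \<Longrightarrow> bottom_point q n i \<in> K"
proof (induction n arbitrary: i)
  case 0
  hence "i = 0 \<or> i = 2^0" by auto
  thus ?case using vertex_in_K[of 1] vertex_in_K[of 2] by (auto simp del: power_0)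
next
  case (Suc n)
  show ?case
    using Suc.prems by (cases rule: bottom_point_Suc_cases) (simp_all add: Suc.IH F_in_K)
qed

lemma lam_0_bottom_point: "i \<le> 2^n \<Longrightarrow> lam 0 (bottom_point q n i) = 0"
proof (induction n arbitrary: i)
  case 0
  hence "i = 0 \<or> i = 2^0" by auto
  thus ?case by (auto simp: lam_vertex simp del: power_0)
next
  case (Suc n)
  show ?case
    using Suc.prems by (cases rule: bottom_point_Suc_cases) (simp_all add: Suc.IH lam_F)
qed

lemma top_neq_bottom_point: "i \<le> 2^n \<Longrightarrow> bottom_point q n i \<noteq> q 0"
  using lam_0_bottom_point[of i n] lam_vertex[of 0 0] by auto

lemma bottom_point_eq_iff: "bottom_point q n i = bottom_point q n j \<longleftrightarrow> i = j"
proof -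
  have "q 2 \<noteq> q 1"
    using inj_on_vertex by (auto simp: inj_on_def lessThan_3)
  thus ?thesis
    by (auto simp: bottom_point_def)
qed

abbreviation trace_energy :: "nat \<Rightarrow> (real^2 \<Rightarrow> real) \<Rightarrow> real" where
  "trace_energy n u \<equiv> trace_form n (u (q 0)) (\<lambda>i. u (bottom_point q n i))"

text \<open>The vertices \<open>q 1\<close> and \<open>q 2\<close> are the bottom points 0 and 1,
  hence the shift \<open>k - 1\<close>.\<close>

lemma trace_form_0: "trace_form 0 a t = E0 (\<lambda>k. if k = 0 then a else t (k - 1))"
proof -
  have "{..2^0} = {0, 1 :: nat}"
    by auto
  thus ?thesis
    by (simp add: trace_form_def pair_form_def alpha_def wt_def E0_def power2_commute)
qed

lemma graph_energy_mono: "m \<le> n \<Longrightarrow> graph_energy q m u \<le> graph_energy q n u"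
  by (rule lift_Suc_mono_le[of "\<lambda>m. graph_energy q m u"]) (rule graph_energy_Suc_mono)

text \<open>The top cell is bounded below by the energy of its three corners, the lower cells by the
  hypothesis at level \<open>n\<close>. The remainder is kept because it later determines the
  midpoint values of a minimiser.\<close>

lemma trace_energy_gap:
  fixes u :: "real^2 \<Rightarrow> real" and n :: nat
  assumes le: "\<And>v. trace_energy n v \<le> graph_energy q n v"
  defines "x \<equiv> u (F 0 (q 1)) - mid_left n (u (q 0)) (\<lambda>i. u (bottom_point q (Suc n) i))"
    and "y \<equiv> u (F 0 (q 2)) - mid_right n (u (q 0)) (\<lambda>i. u (bottom_point q (Suc n) i))"
  shows "trace_energy (Suc n) u + 5/3 * ((x - y)\<^sup>2 + (1 + 2^Suc n * alpha n) * (x\<^sup>2 + y\<^sup>2))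
    \<le> graph_energy q (Suc n) u"
proof -
  let ?a = "u (q 0)" and ?b = "u (F 0 (q 1))" and ?c = "u (F 0 (q 2))"
  let ?t = "\<lambda>i. u (bottom_point q (Suc n) i)"
  have "(?a - ?b)\<^sup>2 + (?b - ?c)\<^sup>2 + (?a - ?c)\<^sup>2 = graph_energy q 0 (u \<circ> F 0)"
    unfolding graph_energy_0 E0_def by simp
  also have "\<dots> \<le> graph_energy q n (u \<circ> F 0)"
    by (rule graph_energy_mono) simp
  finally have top: "(?a - ?b)\<^sup>2 + (?b - ?c)\<^sup>2 + (?a - ?c)\<^sup>2 \<le> graph_energy q n (u \<circ> F 0)" .
  have left: "trace_form n ?b ?t \<le> graph_energy q n (u \<circ> F 1)"
    using le[of "u \<circ> F 1"] unfolding o_def F_bottom_left F_vertex_commute[of 1 0] .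
  have right: "trace_form n ?c (\<lambda>i. ?t (2^n + i)) \<le> graph_energy q n (u \<circ> F 2)"
    using le[of "u \<circ> F 2"] unfolding o_def F_bottom_right F_vertex_commute[of 2 0] .
  have "5/3 * (((?a - ?b)\<^sup>2 + (?b - ?c)\<^sup>2 + (?a - ?c)\<^sup>2) + trace_form n ?b ?t
      + trace_form n ?c (\<lambda>i. ?t (2^n + i))) \<le> graph_energy q (Suc n) u"
    unfolding graph_energy_Suc sum_less_3 using top left right
    by (intro mult_left_mono add_mono) auto
  thus ?thesis
    unfolding x_def y_def
      trace_form_step[where a = ?a and b = ?b and c = ?c and n = n and t = ?t] .
qed

lemma trace_energy_le_graph_energy: "trace_energy n u \<le> graph_energy q n u"
proof (induction n arbitrary: u)
  case 0
  show ?case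
    using bottom_point_end[of 0] by (simp add: trace_form_0 graph_energy_0 E0_def)
next
  case (Suc n)
  have "0 \<le> 5/3 * ((x - y)\<^sup>2 + (1 + 2^Suc n * alpha n) * (x\<^sup>2 + y\<^sup>2))" for x y :: real
    using alpha_pos[of n] by (intro mult_nonneg_nonneg add_nonneg_nonneg) auto
  from add_left_mono[OF this] show ?case
    using trace_energy_gap[OF Suc.IH, of u] by (smt (verit))
qed

lemma trace_energy_le_energy: "ereal (trace_energy n u) \<le> energy q u"
  using trace_energy_le_graph_energy[of n u] graph_energy_le_energy[of n u]
  by (meson ereal_less_eq(3) order_trans)

text \<open>A harmonic top cell and two minimisers of level \<open>n\<close> are glued. Asking for
  equality at all levels from \<open>n\<close> on makes the induction work and gives the energy as
  the limit of an eventually constant sequence.\<close>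

lemma minimiser_exists:
  "\<exists>u. continuous_on K u \<and> u (q 0) = a \<and> (\<forall>i\<le>2^n. u (bottom_point q n i) = t i) \<and>
     (\<forall>m\<ge>n. graph_energy q m u = trace_form n a t)"
proof (induction n arbitrary: a t)
  case 0
  let ?v = "\<lambda>k::nat. if k = 0 then a else t (k - 1)"
  have "harmonic ?v (bottom_point q 0 i) = t i" if "i \<le> 2^0" for i
  proof -
    from that have "i = 0 \<or> i = 1" by auto
    thus ?thesis
      using bottom_point_end[of 0] by (auto simp: harmonic_vertex)
  qed
  thus ?case
    by (intro exI[of _ "harmonic ?v"])
      (simp add: continuous_on_harmonic harmonic_vertex graph_energy_harmonic trace_form_0)
next
  case (Suc n)
  \<comment> \<open>These midpoint values make the remainder in \<open>trace_form_step\<close>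
    vanish.\<close>
  define b c where "b = mid_left n a t" and "c = mid_right n a t"
  obtain u1 where u1: "continuous_on K u1" "u1 (q 0) = b"
      "\<And>i. i \<le> 2^n \<Longrightarrow> u1 (bottom_point q n i) = t i"
      "\<And>m. m \<ge> n \<Longrightarrow> graph_energy q m u1 = trace_form n b t"
    using Suc[of b t] by blast
  obtain u2 where u2: "continuous_on K u2" "u2 (q 0) = c"
      "\<And>i. i \<le> 2^n \<Longrightarrow> u2 (bottom_point q n i) = t (2^n + i)"
      "\<And>m. m \<ge> n \<Longrightarrow> graph_energy q m u2 = trace_form n c (\<lambda>i. t (2^n + i))"
    using Suc[of c "\<lambda>i. t (2^n + i)"] by blast
  define v where "v k = (if k = 0 then a else if k = 1 then b else c)" for k :: nat
  define f where "f i = (if i = 0 then harmonic v else if i = 1 then u1 else u2)" for i :: nat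
  define u where "u = glue f"
  have f: "f 0 = harmonic v" "f 1 = u1" "f 2 = u2"
    by (simp_all add: f_def)
  have v: "v 0 = a" "v 1 = b" "v 2 = c"
    by (simp_all add: v_def)
  \<comment> \<open>The right corner of the left cell and the left corner of the right cell are both
    the midpoint of the bottom side, with index \<open>2^n\<close>.\<close>
  have junction: "u1 (q 2) = t (2^n)" "u2 (q 1) = t (2^n)"
    using u1(3)[of "2^n"] u2(3)[of 0] by simp_all
  have compat: "f i (q j) = f j (q i)" if "i < 3" "j < 3" for i j
    using that[THEN less_3_cases] junction u1(2) u2(2)
    by (elim disjE) (simp_all add: f v harmonic_vertex flip: One_nat_def)
  have uF: "u (F i x) = f i x" if "i < 3" "x \<in> K" for i x
    unfolding u_def using compat that by (rule glue_F)
  have cont: "continuous_on K u"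
    unfolding u_def
  proof (rule continuous_on_glue)
    show "f i (q j) = f j (q i)" if "i < 3" "j < 3" for i j
      using that by (rule compat)
    show "continuous_on K (f i)" if "i < 3" for i
      using less_3_cases[OF that] by (auto simp: f_def continuous_on_harmonic u1 u2)
  qed
  have top: "u (q 0) = a"
    using uF[of 0 "q 0"] by (simp add: vertex_in_K f harmonic_vertex v)
  have bottom: "u (bottom_point q (Suc n) i) = t i" if "i \<le> 2^Suc n" for i
    using that
  proof (cases rule: bottom_point_Suc_cases)
    case 1
    thus ?thesis
      using uF[of 1] f(2) u1(3) bottom_point_in_K by simp
  next
    case (2 k)
    thus ?thesis
      using uF[of 2] f(3) u2(3) bottom_point_in_K by simp
  qed
  have energy: "graph_energy q m u = trace_form (Suc n) a t" if m: "m \<ge> Suc n" for m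
  proof -
    obtain m' where m': "m = Suc m'" "m' \<ge> n"
      using m by (cases m) auto
    have "graph_energy q m' (u \<circ> F i) = graph_energy q m' (f i)" if "i < 3" for i
      using uF that by (intro graph_energy_cong) auto
    hence "graph_energy q m u =
        5/3 * (graph_energy q m' (f 0) + graph_energy q m' (f 1) + graph_energy q m' (f 2))"
      unfolding m' graph_energy_Suc sum_less_3 by simp
    also have "\<dots> = 5/3 * (((a - b)\<^sup>2 + (b - c)\<^sup>2 + (a - c)\<^sup>2) + trace_form n b t
        + trace_form n c (\<lambda>i. t (2^n + i)))"
      unfolding f graph_energy_harmonic u1(4)[OF m'(2)] u2(4)[OF m'(2)] E0_def v ..
    also have "\<dots> = trace_form (Suc n) a t"
      unfolding trace_form_step by (simp add: b_def c_def)
    finally show ?thesis .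
  qed
  show ?case
    using cont top bottom energy by blast
qed

lemma ball_top_and_bottom:
  "(\<forall>x\<in>top_and_bottom q n. v x = u x) \<longleftrightarrow>
    v (q 0) = u (q 0) \<and> (\<forall>i\<le>2^n. v (bottom_point q n i) = u (bottom_point q n i))"
  by (auto simp: top_and_bottom_def)

lemma trace_energy_cong:
  assumes "v (q 0) = u (q 0)" "\<And>i. i \<le> 2^n \<Longrightarrow> v (bottom_point q n i) = u (bottom_point q n i)"
  shows "trace_energy n v = trace_energy n u"
  unfolding assms(1) by (rule trace_form_cong) (rule assms(2))

lemma least_energy_exists:
  "\<exists>u. least_energy q (top_and_bottom q n) u \<and> u (q 0) = a \<and>
     (\<forall>i\<le>2^n. u (bottom_point q n i) = t i) \<and> energy q u = ereal (trace_form n a t)"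
proof -
  obtain u where u: "continuous_on K u" "u (q 0) = a"
      "\<And>i. i \<le> 2^n \<Longrightarrow> u (bottom_point q n i) = t i"
      "\<And>m. m \<ge> n \<Longrightarrow> graph_energy q m u = trace_form n a t"
    using minimiser_exists by blast
  have e: "energy q u = ereal (trace_form n a t)"
    using u(4) by (rule energy_eqI)
  have tr: "trace_energy n u = trace_form n a t"
    unfolding u(2) by (rule trace_form_cong) (rule u(3))
  have "least_energy q (top_and_bottom q n) u"
    unfolding least_energy_def ball_top_and_bottom
  proof (intro conjI ballI impI)
    show "u \<in> dom_energy q"
      using u(1) e by (simp add: dom_energy_def SG_eq_K)
    fix w assume "w (q 0) = u (q 0) \<and> (\<forall>i\<le>2^n. w (bottom_point q n i) = u (bottom_point q n i))"
    hence "trace_energy n w = trace_energy n u"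
      by (intro trace_energy_cong) auto
    thus "energy q u \<le> energy q w"
      using trace_energy_le_energy[of n w] by (simp only: e tr)
  qed
  thus ?thesis
    using u e by blast
qed

text \<open>The lower bound holds for every function; the upper bound comes from comparison with the
  explicit minimiser having the same boundary values.\<close>

lemma energy_least_energy:
  assumes "least_energy q (top_and_bottom q n) u"
  shows "energy q u = ereal (trace_energy n u)"
proof (rule antisym)
  obtain w where w: "least_energy q (top_and_bottom q n) w" "w (q 0) = u (q 0)"
      "\<forall>i\<le>2^n. w (bottom_point q n i) = u (bottom_point q n i)"
      "energy q w = ereal (trace_energy n u)"
    using least_energy_exists[of n "u (q 0)" "\<lambda>i. u (bottom_point q n i)"] by blast
  have "w \<in> dom_energy q" "\<forall>x\<in>top_and_bottom q n. w x = u x"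
    using w by (auto simp: least_energy_def ball_top_and_bottom)
  thus "energy q u \<le> ereal (trace_energy n u)"
    using assms w(4) by (auto simp: least_energy_def)
qed (rule trace_energy_le_energy)

text \<open>The graph energy of a minimiser at level \<open>Suc n\<close> is at most its trace
  energy, so the remainder in \<open>trace_energy_gap\<close> is at most 0 and, being positive
  definite, forces both deviations to vanish.\<close>

lemma least_energy_midpoints:
  assumes "least_energy q (top_and_bottom q (Suc n)) u"
  shows "u (F 0 (q 1)) = mid_left n (u (q 0)) (\<lambda>i. u (bottom_point q (Suc n) i))"
    and "u (F 0 (q 2)) = mid_right n (u (q 0)) (\<lambda>i. u (bottom_point q (Suc n) i))"
proof -
  define x where "x = u (F 0 (q 1)) - mid_left n (u (q 0)) (\<lambda>i. u (bottom_point q (Suc n) i))"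
  define y where "y = u (F 0 (q 2)) - mid_right n (u (q 0)) (\<lambda>i. u (bottom_point q (Suc n) i))"
  define k where "k = 1 + 2^Suc n * alpha n"
  have k: "k > 0"
    unfolding k_def using alpha_pos[of n] by (intro add_pos_pos mult_pos_pos) auto
  have cancel: "z \<le> 0" if "A + 5/3 * z \<le> B" "B \<le> A" for z A B :: real
    using that by linarith
  have "graph_energy q (Suc n) u \<le> trace_energy (Suc n) u"
    using graph_energy_le_energy[of "Suc n" u] energy_least_energy[OF assms] by simp
  hence "(x - y)\<^sup>2 + k * (x\<^sup>2 + y\<^sup>2) \<le> 0"
    using trace_energy_gap[OF trace_energy_le_graph_energy, of n u, folded x_def y_def k_def]
    by (rule cancel[rotated])
  hence "k * (x\<^sup>2 + y\<^sup>2) \<le> 0"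
    using zero_le_power2[of "x - y"] by linarith
  hence "x\<^sup>2 + y\<^sup>2 \<le> 0"
    using k by (simp add: mult_le_0_iff)
  hence "x = 0" "y = 0"
    by (simp_all add: sum_power2_le_zero_iff)
  thus "u (F 0 (q 1)) = mid_left n (u (q 0)) (\<lambda>i. u (bottom_point q (Suc n) i))"
    and "u (F 0 (q 2)) = mid_right n (u (q 0)) (\<lambda>i. u (bottom_point q (Suc n) i))"
    by (simp_all add: x_def y_def)
qed

section \<open>Recovering the conductances from the energy form\<close>

lemma pair_form_zero:
  fixes e :: "'a \<Rightarrow> 'a \<Rightarrow> real"
  assumes fin: "finite A" and sym: "\<And>u v. e u v = e v u"
    and zero: "\<And>f. (\<Sum>u\<in>A. \<Sum>v\<in>A. e u v * (f u - f v)\<^sup>2) = 0"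
    and xy: "x \<in> A" "y \<in> A" "x \<noteq> y"
  shows "e x y = 0"
proof -
  \<comment> \<open>polarisation with the indicators of \<open>x\<close> and \<open>y\<close>\<close>
  define f g where "f u = (if u = x then 1 else 0 :: real)" and "g u = (if u = y then 1 else 0 :: real)"
    for u
  have "e u v * (((f u + g u) - (f v + g v))\<^sup>2 - (f u - f v)\<^sup>2 - (g u - g v)\<^sup>2) =
      (if u = x then (if v = y then - 2 * e x y else 0) else 0) +
      (if u = y then (if v = x then - 2 * e x y else 0) else 0)" for u v
    using xy(3) sym[of y x] by (auto simp: f_def g_def)
  hence "(\<Sum>u\<in>A. \<Sum>v\<in>A. e u v * (((f u + g u) - (f v + g v))\<^sup>2 - (f u - f v)\<^sup>2 - (g u - g v)\<^sup>2)) =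
      (\<Sum>u\<in>A. \<Sum>v\<in>A. (if u = x then (if v = y then - 2 * e x y else 0) else 0) +
      (if u = y then (if v = x then - 2 * e x y else 0) else 0))"
    by simp
  \<comment> \<open>The ordered pairs (x, y) and (y, x) contribute \<open>- 2 * e x y\<close>
    each.\<close>
  also have "\<dots> = - 4 * e x y"
  proof -
    have *: "(\<Sum>v\<in>A. if u = w then (if v = z then c else 0) else 0) = (if u = w then c else 0)"
      if "z \<in> A" for u w z :: 'a and c :: real
      using that fin by simp
    show ?thesis
      using fin xy by (simp add: sum.distrib *)
  qed
  finally show ?thesis
    unfolding right_diff_distrib sum_subtractf
    using zero[of f] zero[of g] zero[of "\<lambda>u. f u + g u"] by simp
qed

text \<open>Lets conductances be read off from an indexed quadratic form. Minimisers exist for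
  arbitrary boundary values, so two admissible coefficient systems define the same form and agree by
  \<open>pair_form_zero\<close>.\<close>

lemma conductance_eqI:
  fixes p :: "nat \<Rightarrow> real^2" and cc :: "nat \<Rightarrow> nat \<Rightarrow> real"
  assumes fin: "finite I" and inj: "inj_on p I" and sym: "\<And>i j. cc i j = cc j i"
    and ex: "\<And>f. \<exists>u. least_energy q (p ` I) u \<and> (\<forall>x\<in>p ` I. u x = f x)"
    and en: "\<And>u. least_energy q (p ` I) u \<Longrightarrow>
      energy q u = ereal ((1/2) * (\<Sum>i\<in>I. \<Sum>j\<in>I. cc i j * (u (p i) - u (p j))\<^sup>2))"
    and ij: "i \<in> I" "j \<in> I" "i \<noteq> j"
  shows "conductance q (p ` I) (p i) (p j) = cc i j"
proof -
  let ?A = "p ` I"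
  define k where "k = inv_into I p"
  \<comment> \<open>Diagonal entries of \<open>cc\<close> may be nonzero, but they multiply a
    vanishing square; \<open>c0\<close> resets them to the default 0 demanded by
    \<open>conductance\<close>.\<close>
  define c0 where "c0 x y = (if x \<in> ?A \<and> y \<in> ?A \<and> x \<noteq> y then cc (k x) (k y) else 0)" for x y
  have k: "k (p i) = i" if "i \<in> I" for i
    unfolding k_def using inj that by (rule inv_into_f_f)
  have c0: "c0 (p i) (p j) = cc i j" if "i \<in> I" "j \<in> I" "i \<noteq> j" for i j
    using that inj by (auto simp: c0_def k inj_on_eq_iff)
  have c0_sym: "c0 x y = c0 y x" for x y
    using sym by (auto simp: c0_def)
  have sum0: "(\<Sum>x\<in>?A. \<Sum>y\<in>?A. c0 x y * (u x - u y)\<^sup>2) =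
      (\<Sum>i\<in>I. \<Sum>j\<in>I. cc i j * (u (p i) - u (p j))\<^sup>2)" for u
  proof -
    have "c0 (p i) (p j) * (u (p i) - u (p j))\<^sup>2 = cc i j * (u (p i) - u (p j))\<^sup>2"
      if "i \<in> I" "j \<in> I" for i j
      using that c0 by (cases "i = j") auto
    thus ?thesis
      unfolding sum.reindex[OF inj] o_def by (intro sum.cong refl)
  qed
  have "conductance q ?A = c0"
    unfolding conductance_def
  proof (rule the_equality, goal_cases)
    case 1
    show ?case
      using c0_sym en sum0 by (auto simp: c0_def)
  next
    case (2 c)
    have sums: "(\<Sum>x\<in>?A. \<Sum>y\<in>?A. (c x y - c0 x y) * (f x - f y)\<^sup>2) = 0" for f
    proof -
      obtain u where u: "least_energy q ?A u" "\<forall>x\<in>?A. u x = f x"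
        using ex by blast
      have "ereal ((1/2) * (\<Sum>x\<in>?A. \<Sum>y\<in>?A. c x y * (u x - u y)\<^sup>2)) =
          ereal ((1/2) * (\<Sum>x\<in>?A. \<Sum>y\<in>?A. c0 x y * (u x - u y)\<^sup>2))"
        using 2 u(1) en[OF u(1)] sum0[of u] by simp
      hence "(\<Sum>x\<in>?A. \<Sum>y\<in>?A. c x y * (u x - u y)\<^sup>2) = (\<Sum>x\<in>?A. \<Sum>y\<in>?A. c0 x y * (u x - u y)\<^sup>2)"
        by simp
      moreover have "(\<Sum>x\<in>?A. \<Sum>y\<in>?A. d x y * (u x - u y)\<^sup>2) =
          (\<Sum>x\<in>?A. \<Sum>y\<in>?A. d x y * (f x - f y)\<^sup>2)" for d :: "real^2 \<Rightarrow> real^2 \<Rightarrow> real"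
        using u(2) by (intro sum.cong refl) auto
      ultimately show ?thesis
        unfolding left_diff_distrib sum_subtractf by simp
    qed
    have "c x y = c0 x y" for x y
    proof (cases "x \<in> ?A \<and> y \<in> ?A \<and> x \<noteq> y")
      case True
      have "c x y - c0 x y = 0"
      proof (rule pair_form_zero[where e = "\<lambda>x y. c x y - c0 x y" and A = ?A])
        show "c u v - c0 u v = c v u - c0 v u" for u v
          using 2 c0_sym[of u v] by metis
      qed (use True fin sums in auto)
      thus ?thesis by simp
    next
      case False
      thus ?thesis
        using 2 by (auto simp: c0_def)
    qed
    thus ?case
      by (intro ext)
  qed
  thus ?thesis
    using c0[OF ij] by simp
qed

lemma top_conductance_eq:
  assumes j: "j \<le> 2^n"
  shows "top_conductance q n j = alpha n * wt n j"
proof -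
  let ?I = "{..Suc (2^n)}"
  \<comment> \<open>The top point takes the index \<open>Suc (2^n)\<close>, just after the last
    bottom index.\<close>
  define p where "p i = (if i \<le> 2^n then bottom_point q n i else q 0)" for i
  define cc where "cc i j = (if i \<le> 2^n then if j \<le> 2^n then bottom_cond n i j else alpha n * wt n i
    else if j \<le> 2^n then alpha n * wt n j else 0)" for i j
  have p: "p i = bottom_point q n i" if "i \<le> 2^n" for i
    using that by (simp add: p_def)
  have p_top: "p (Suc (2^n)) = q 0"
    by (simp add: p_def)
  have A: "top_and_bottom q n = p ` ?I"
  proof -
    have "bottom_point q n ` {..2^n} = p ` {..2^n}"
      by (intro image_cong refl) (simp add: p)
    thus ?thesis
      unfolding top_and_bottom_def atMost_Suc image_insert p_top by simp
  qed
  have form: "(1/2) * (\<Sum>i\<in>?I. \<Sum>j\<in>?I. cc i j * (u (p i) - u (p j))\<^sup>2) = trace_energy n u" for u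
  proof -
    define a t where "a = u (q 0)" and "t i = u (bottom_point q n i)" for i
    have 2: "(\<Sum>j\<le>2^n. cc (Suc (2^n)) j * (u (p (Suc (2^n))) - u (p j))\<^sup>2) =
        alpha n * (\<Sum>j\<le>2^n. wt n j * (a - t j)\<^sup>2)"
      unfolding sum_distrib_left by (intro sum.cong refl) (simp add: cc_def p p_top a_def t_def)
    have 3: "(\<Sum>i\<le>2^n. cc i (Suc (2^n)) * (u (p i) - u (p (Suc (2^n))))\<^sup>2) =
        alpha n * (\<Sum>j\<le>2^n. wt n j * (a - t j)\<^sup>2)"
      unfolding sum_distrib_left
      by (intro sum.cong refl) (simp add: cc_def p p_top a_def t_def power2_commute)
    have 4: "(\<Sum>i\<le>2^n. \<Sum>j\<le>2^n. cc i j * (u (p i) - u (p j))\<^sup>2) = pair_form n t"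
      unfolding pair_form_def by (intro sum.cong refl) (simp add: cc_def p t_def)
    show ?thesis
      unfolding sum.atMost_Suc sum.distrib 2 3 4 a_def[symmetric] t_def[symmetric] trace_form_def
      by simp
  qed
  have "conductance q (p ` ?I) (p (Suc (2^n))) (p j) = cc (Suc (2^n)) j"
  proof (rule conductance_eqI)
    show "inj_on p ?I"
    proof (rule inj_onI)
      fix i k assume "i \<in> ?I" "k \<in> ?I" "p i = p k"
      thus "i = k"
        using top_neq_bottom_point[of i n] top_neq_bottom_point[of k n]
        by (auto simp: p_def bottom_point_eq_iff le_Suc_eq split: if_splits)
    qed
    show "cc i k = cc k i" for i k
      by (simp add: cc_def bot_commute)
    show "\<exists>u. least_energy q (p ` ?I) u \<and> (\<forall>x\<in>p ` ?I. u x = f x)" for f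
    proof -
      obtain u where "least_energy q (top_and_bottom q n) u" "u (q 0) = f (q 0)"
          "\<forall>i\<le>2^n. u (bottom_point q n i) = f (bottom_point q n i)"
        using least_energy_exists[of n "f (q 0)" "\<lambda>i. f (bottom_point q n i)"] by blast
      thus ?thesis
        unfolding A[symmetric] ball_top_and_bottom by (intro exI conjI)
    qed
    show "energy q u = ereal ((1/2) * (\<Sum>i\<in>?I. \<Sum>j\<in>?I. cc i j * (u (p i) - u (p j))\<^sup>2))"
      if "least_energy q (p ` ?I) u" for u
      unfolding form using that by (intro energy_least_energy) (simp only: A)
  qed (use j in auto)
  thus ?thesis
    unfolding top_conductance_def A p_top p[OF j] by (simp add: cc_def j)
qed

end

section \<open>Explicit weighted sums and the final formulas\<close>

lemma sum_wt_explicit: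
  "(\<Sum>i\<le>2^n. wt n i * f i) = f 0 + 2 * (\<Sum>i\<in>{1..2^n - 1}. f i) + f (2^n)"
proof -
  define N M where "N = (2::nat)^n" and "M = {1..N - 1}"
  have "N > 0"
    by (simp add: N_def)
  \<comment> \<open>For \<open>n = 0\<close> the interior \<open>M\<close> is empty;
    \<open>N > 0\<close> keeps the two endpoints distinct.\<close>
  hence set: "{..N} = insert 0 (insert N M)" "0 \<notin> insert N M" "N \<notin> M" "finite M"
    by (auto simp: M_def)
  have "(\<Sum>i\<in>M. wt n i * f i) = 2 * (\<Sum>i\<in>M. f i)"
    unfolding sum_distrib_left using \<open>N > 0\<close>
    by (intro sum.cong refl) (auto simp: wt_def M_def simp flip: N_def)
  moreover have "wt n 0 = 1" "wt n N = 1"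
    by (simp_all add: wt_def N_def)
  ultimately show ?thesis
    unfolding N_def[symmetric] M_def[symmetric] set(1) using set(2-4) by simp
qed

lemma sum_wt_shift_explicit:
  "(\<Sum>i\<le>2^n. wt n i * f (2^n + i)) =
    f (2^n) + 2 * (\<Sum>i\<in>{2^n + 1..2^(n + 1) - 1}. f i) + f (2^(n + 1))"
proof -
  have shift: "(\<Sum>i\<in>{1..N - 1}. f (N + i)) = (\<Sum>i\<in>{N + 1..2 * N - 1}. f i)" for N
    by (rule sum.reindex_bij_witness[of _ "\<lambda>i. i - N" "\<lambda>i. N + i"]) auto
  have two: "(2::nat)^(n + 1) = 2 * 2^n"
    by simp
  show ?thesis
    unfolding sum_wt_explicit[where f = "\<lambda>i. f (2^n + i)"] shift two
    by (simp only: add_0_right mult_2)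
qed

theorem lemma2p17:
  fixes q :: "nat \<Rightarrow> real^2" and n :: nat
  assumes "equilateral_triangle q"
  shows "top_conductance q n (2^n) = corner_conductance q n \<and>
    (\<forall>j. 0 < j \<and> j < 2^n \<longrightarrow> top_conductance q n j = 2 * corner_conductance q n) \<and>
    corner_conductance q n = 7 * 5^n / (3^n + 6 * 10^n) \<and>
    (\<forall>(u :: real^2 \<Rightarrow> real) (a :: real) (t :: nat \<Rightarrow> real) (\<alpha> :: real) (L :: real) (R :: real).
       least_energy q (top_and_bottom q (n + 1)) u \<and>
       u (q 0) = a \<and>
       (\<forall>i \<le> 2^(n + 1). u (bottom_point q (n + 1) i) = t i) \<and>
       \<alpha> = corner_conductance q n \<and>
       L = t 0 + 2 * (\<Sum>i\<in>{1..2^n - 1}. t i) + t (2^n) \<and>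
       R = t (2^n) + 2 * (\<Sum>i\<in>{2^n + 1..2^(n + 1) - 1}. t i) + t (2^(n + 1)) \<longrightarrow>
       u ((1/2) *\<^sub>R (q 0 + q 1)) =
         ((3 + 2^(n + 1) * \<alpha>) * a + (2 + 2^(n + 1) * \<alpha>) * \<alpha> * L + \<alpha> * R)
           / ((1 + 2^(n + 1) * \<alpha>) * (3 + 2^(n + 1) * \<alpha>)) \<and>
       u ((1/2) *\<^sub>R (q 0 + q 2)) =
         ((3 + 2^(n + 1) * \<alpha>) * a + \<alpha> * L + (2 + 2^(n + 1) * \<alpha>) * \<alpha> * R)
           / ((1 + 2^(n + 1) * \<alpha>) * (3 + 2^(n + 1) * \<alpha>)))"
proof -
  interpret gasket q
    by unfold_locales (rule assms)
  have corner: "corner_conductance q n = alpha n"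
    by (simp add: corner_conductance_def top_conductance_eq wt_def)
  show ?thesis
  proof (rule conjI[OF _ conjI[OF _ conjI]], goal_cases)
    case 1
    show ?case
      unfolding corner by (simp add: top_conductance_eq wt_def)
  next
    case 2
    show ?case
      unfolding corner by (simp add: top_conductance_eq wt_def)
  next
    case 3
    show ?case
      unfolding corner by (rule alpha_def)
  next
    case 4
    show ?case
    proof (intro allI impI, goal_cases)
      case (1 u a t \<alpha> L R)
      define v where "v i = u (bottom_point q (n + 1) i)" for i
      have v: "v i = t i" if "i \<le> 2^(n + 1)" for i
        using 1 that by (simp add: v_def)
      have "(\<Sum>i\<le>2^n. wt n i * v i) = (\<Sum>i\<le>2^n. wt n i * t i)"
          "(\<Sum>i\<le>2^n. wt n i * v (2^n + i)) = (\<Sum>i\<le>2^n. wt n i * t (2^n + i))"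
        using v by (auto intro!: sum.cong)
      moreover have "(\<Sum>i\<le>2^n. wt n i * t i) = L"
        using 1 by (simp only: sum_wt_explicit)
      moreover have "(\<Sum>i\<le>2^n. wt n i * t (2^n + i)) = R"
        using 1 by (simp only: sum_wt_shift_explicit)
      ultimately have LR: "(\<Sum>i\<le>2^n. wt n i * v i) = L" "(\<Sum>i\<le>2^n. wt n i * v (2^n + i)) = R"
        by simp_all
      \<comment> \<open>This factorisation produces the stated denominator. In the numerators the
        two occurrences of \<open>a\<close> have coefficients
        \<open>2 + 2^(n + 1) * \<alpha>\<close> and 1, which add up to
        \<open>3 + 2^(n + 1) * \<alpha>\<close>.\<close>
      have s: "(2 + 2^(n + 1) * \<alpha>)\<^sup>2 - 1 = (1 + 2^(n + 1) * \<alpha>) * (3 + 2^(n + 1) * \<alpha>)"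
        by (simp add: power2_eq_square algebra_simps)
      have "least_energy q (top_and_bottom q (Suc n)) u" "u (q 0) = a" "alpha n = \<alpha>"
        using 1 corner by simp_all
      from least_energy_midpoints[OF this(1), unfolded mid_left_def mid_right_def Let_def this(2,3)]
      have "u (F 0 (q 1)) = ((2 + 2^(n + 1) * \<alpha>) * (a + \<alpha> * L) + (a + \<alpha> * R)) / ((2 + 2^(n + 1) * \<alpha>)\<^sup>2 - 1)"
        "u (F 0 (q 2)) = ((a + \<alpha> * L) + (2 + 2^(n + 1) * \<alpha>) * (a + \<alpha> * R)) / ((2 + 2^(n + 1) * \<alpha>)\<^sup>2 - 1)"
        using LR by (simp_all add: v_def)
      moreover have "F 0 (q 1) = (1/2) *\<^sub>R (q 0 + q 1)" "F 0 (q 2) = (1/2) *\<^sub>R (q 0 + q 2)"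
        by (simp_all add: sg_map_def add.commute)
      ultimately show ?case
        unfolding s by (simp add: algebra_simps)
    qed
  qed
qed


end
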